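(* Let $\mathcal T_0$ be an initial conforming mesh with suitable initial labeling. Let $\mathcal T_k$ be a $\Lambda$-admissible refinement of $\mathcal T_0$ by newest-vertex bisection created by successive calls $\mathcal T_{j+1}=$ REFINE$(\mathcal T_j,\mathcal M_j)$, $0\le j\le k-1$, where $\mathcal M_j\subset\mathcal T_j$. Then there exists a universal constant $C_0>0$, solely depending on $\mathcal T_0$ and its labeling, such that $$\#\mathcal T_k-\#\mathcal T_0\le C_0\sum_{j=0}^{k-1}\#\mathcal M_j .$$
   Context: **Meshes.** $\mathcal T_0$ is a conforming triangulation of the closure of a bounded polygonal domain $\Omega\subset\mathbb R^2$, each triangle having an assigned newest vertex. Refinements $\mathcal T$ of $\mathcal T_0$ are obtained by finitely many newest-vertex bisections; hanging nodes are allowed. Nodes are the vertices of triangles of $\mathcal T$; a node is proper if it is a vertex of all triangles containing it, otherwise hanging. A hanging node $x$ was created as midpoint of a side $[x',x'']$ of a triangle of a preceding mesh. Global index: $\lambda(x)=0$ if $x$ is proper, $\lambda(x)=\max(\lambda(x'),\lambda(x''))+1$ if $x$ is hanging. For a fixed $\Lambda\ge1$, $\mathcal T$ is $\Lambda$-admissible if all its nodes have global index $\le\Lambda$. **Bisection.** For a triangle $E$, $nv(E)$ is its newest vertex, $oe(E)$ the opposite side, $moe(E)$ the midpoint of $oe(E)$; bisection joins $nv(E)$ with $moe(E)$, and $moe(E)$ is the newest vertex of both children. Suitable initial labeling: a side shared by two triangles of $\mathcal T_0$ is opposite to the newest vertex of both or of neither. $\lambda(moe(E))$ is the global index that $moe(E)$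 has, or would have once $E$ is bisected. **REFINE.** Two elements $E',E''$ of a mesh are adjacent if $e=E'\cap E''$ is a side of at least one of them; they are compatible if moreover neither $nv(E')$ nor $nv(E'')$ lies on the line containing $e$. If $\lambda(moe(E))>\Lambda$, the facing element of $E$ is the unique adjacent $\widetilde E\ne E$ with $E\cap\widetilde E=oe(E)$. Chain of $E$: $E_0=E$; given $E_k$: (i) if $\lambda(moe(E_k))\le\Lambda$, stop with $K=k$; (ii) if $\lambda(moe(E_k))=\Lambda+1$ and the facing element $\widetilde E_k$ is compatible with $E_k$, set $E_{k+1}=\widetilde E_k$, $K=k+1$ and stop; (iii) if $\lambda(moe(E_k))=\Lambda+1$ and $\widetilde E_k$ is not compatible with $E_k$, set $E_{k+1}=\widetilde E_k$ and continue. CREATE_ADMISSIBLE_CHAIN$(\mathcal T,E)$ traverses the chain $\{E_0,\dots,E_K\}$ backwards: for $k=K,\dots,1$, $E_k$ is bisected once if compatible with $E_{k-1}$; otherwise $E_k$ is bisected and then its child facing $E_{k-1}$ is bisected; finally $E_0=E$ is bisected once. REFINE$(\mathcal T,\mathcal M)$ applies this procedure successively to the elements $E\in\mathcal M$ that are still in the current mesh, updating the mesh each time, and returns the final mesh. *)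

theory Defs
  imports "HOL-Analysis.Analysis"
begin

section \<open>Labelled triangles and newest-vertex bisection\<close>

type_synonym point = "real ^ 2"

text \<open>A triangle is given by its set of vertices and its newest vertex, so that a triangle with a
  given newest vertex has exactly one representation and meshes can be counted with \<^const>\<open>card\<close>.\<close>

datatype triangle = Triangle (verts: "point set") (nv: point)

type_synonym mesh = "triangle set"

definition is_triangle :: "triangle \<Rightarrow> bool" where
  "is_triangle E \<longleftrightarrow> card (verts E) = 3 \<and> \<not> collinear (verts E) \<and> nv E \<in> verts E"

definition region :: "triangle \<Rightarrow> point set" where
  "region E = convex hull (verts E)"

definition sides :: "triangle \<Rightarrow> point set set" where
  "sides E = {closed_segment a b | a b. a \<in> verts E \<and> b \<in> verts E \<and> a \<noteq> b}"

definition oe_ends :: "triangle \<Rightarrow> point set" where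
  "oe_ends E = verts E - {nv E}"

definition oe :: "triangle \<Rightarrow> point set" where
  "oe E = convex hull (oe_ends E)"

text \<open>If \<open>oe_ends E = {a, b}\<close> with \<open>a \<noteq> b\<close>, the following is \<open>midpoint a b\<close>.\<close>

definition moe :: "triangle \<Rightarrow> point" where
  "moe E = (\<Sum>p\<in>oe_ends E. p) /\<^sub>R 2"

definition children :: "triangle \<Rightarrow> triangle set" where
  "children E = {Triangle {nv E, moe E, a} (moe E) | a. a \<in> oe_ends E}"

definition bisect :: "mesh \<Rightarrow> triangle \<Rightarrow> mesh" where
  "bisect T E = (T - {E}) \<union> children E"

inductive refinement :: "mesh \<Rightarrow> mesh \<Rightarrow> bool" for T0 where
  refinement_refl: "refinement T0 T0"
| refinement_bisect: "refinement T0 T \<Longrightarrow> E \<in> T \<Longrightarrow> refinement T0 (bisect T E)"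


section \<open>Initial meshes\<close>

definition polygonal_domain :: "point set \<Rightarrow> bool" where
  "polygonal_domain \<Omega> \<longleftrightarrow>
     open \<Omega> \<and> connected \<Omega> \<and> \<Omega> \<noteq> {} \<and>
     (\<exists>S. finite S \<and> frontier \<Omega> = (\<Union>(a, b)\<in>S. closed_segment a b))"

definition conforming_triangulation :: "point set \<Rightarrow> mesh \<Rightarrow> bool" where
  "conforming_triangulation D T \<longleftrightarrow>
     finite T \<and> (\<forall>E\<in>T. is_triangle E) \<and> (\<Union>E\<in>T. region E) = D \<and>
     (\<forall>E\<in>T. \<forall>F\<in>T. E \<noteq> F \<longrightarrow>
        region E \<inter> region F = {} \<or>
        (\<exists>x \<in> verts E \<inter> verts F. region E \<inter> region F = {x}) \<or>
        region E \<inter> region F \<in> sides E \<inter> sides F)"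

definition suitable_labeling :: "mesh \<Rightarrow> bool" where
  "suitable_labeling T \<longleftrightarrow>
     (\<forall>E\<in>T. \<forall>F\<in>T. E \<noteq> F \<longrightarrow> (\<forall>e \<in> sides E \<inter> sides F. e = oe E \<longleftrightarrow> e = oe F))"


section \<open>Global index and admissibility\<close>

definition nodes :: "mesh \<Rightarrow> point set" where
  "nodes T = (\<Union>E\<in>T. verts E)"

definition proper_node :: "mesh \<Rightarrow> point \<Rightarrow> bool" where
  "proper_node T x \<longleftrightarrow> x \<in> nodes T \<and> (\<forall>E\<in>T. x \<in> region E \<longrightarrow> x \<in> verts E)"

definition hanging_node :: "mesh \<Rightarrow> point \<Rightarrow> bool" where
  "hanging_node T x \<longleftrightarrow> x \<in> nodes T \<and> \<not> proper_node T x"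

text \<open>\<open>created_between T0 T x a b\<close>: some sequence of bisections leading from \<open>T0\<close> to \<open>T\<close> introduces
  the node \<open>x\<close> as the midpoint of the side \<open>[a, b]\<close> of an element \<open>E\<close> of a preceding mesh \<open>S\<close>.
  Bisection only creates midpoints of sides opposite to newest vertices. A mesh does not record the
  order of the bisections producing it, but for a conforming \<open>T0\<close> with suitable labeling the side
  does not depend on that order.\<close>

definition created_between :: "mesh \<Rightarrow> mesh \<Rightarrow> point \<Rightarrow> point \<Rightarrow> point \<Rightarrow> bool" where
  "created_between T0 T x a b \<longleftrightarrow>
     (\<exists>S E. refinement T0 S \<and> E \<in> S \<and> refinement (bisect S E) T \<and>
            x \<notin> nodes S \<and> x = moe E \<and> oe_ends E = {a, b})"

inductive has_global_index :: "mesh \<Rightarrow> mesh \<Rightarrow> point \<Rightarrow> nat \<Rightarrow> bool" for T0 T where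
  index_proper: "proper_node T x \<Longrightarrow> has_global_index T0 T x 0"
| index_hanging: "hanging_node T x \<Longrightarrow> created_between T0 T x a b \<Longrightarrow>
    has_global_index T0 T a m \<Longrightarrow> has_global_index T0 T b n \<Longrightarrow>
    has_global_index T0 T x (max m n + 1)"

definition global_index :: "mesh \<Rightarrow> mesh \<Rightarrow> point \<Rightarrow> nat" where
  "global_index T0 T x = (THE n. has_global_index T0 T x n)"

definition admissible_refinement :: "mesh \<Rightarrow> nat \<Rightarrow> mesh \<Rightarrow> bool" where
  "admissible_refinement T0 \<Lambda> T \<longleftrightarrow>
     refinement T0 T \<and> (\<forall>x\<in>nodes T. global_index T0 T x \<le> \<Lambda>)"

text \<open>The index \<open>\<lambda>(moe(E))\<close> that \<open>moe(E)\<close> has, or would have once \<open>E\<close> is bisected.\<close>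

definition moe_index :: "mesh \<Rightarrow> mesh \<Rightarrow> triangle \<Rightarrow> nat" where
  "moe_index T0 T E =
     (if moe E \<in> nodes T then global_index T0 T (moe E)
      else global_index T0 (bisect T E) (moe E))"


section \<open>The refinement procedure\<close>

definition adjacent :: "triangle \<Rightarrow> triangle \<Rightarrow> bool" where
  "adjacent E F \<longleftrightarrow> region E \<inter> region F \<in> sides E \<union> sides F"

definition compatible :: "triangle \<Rightarrow> triangle \<Rightarrow> bool" where
  "compatible E F \<longleftrightarrow> adjacent E F \<and>
     nv E \<notin> affine hull (region E \<inter> region F) \<and> nv F \<notin> affine hull (region E \<inter> region F)"

definition facing :: "mesh \<Rightarrow> triangle \<Rightarrow> triangle \<Rightarrow> bool" where
  "facing T E F \<longleftrightarrow> F \<in> T \<and> F \<noteq> E \<and> adjacent E F \<and> region E \<inter> region F = oe E"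

text \<open>\<open>is_chain T0 \<Lambda> T [E\<^sub>0, \<dots>, E\<^sub>K]\<close>: the list is the chain of \<open>E\<^sub>0\<close> in the mesh \<open>T\<close>.\<close>

inductive is_chain :: "mesh \<Rightarrow> nat \<Rightarrow> mesh \<Rightarrow> triangle list \<Rightarrow> bool" for T0 \<Lambda> T where
  chain_stop: "moe_index T0 T E \<le> \<Lambda> \<Longrightarrow> is_chain T0 \<Lambda> T [E]"
| chain_compatible: "moe_index T0 T E = \<Lambda> + 1 \<Longrightarrow> facing T E F \<Longrightarrow> compatible F E \<Longrightarrow>
    is_chain T0 \<Lambda> T [E, F]"
| chain_continue: "moe_index T0 T E = \<Lambda> + 1 \<Longrightarrow> facing T E F \<Longrightarrow> \<not> compatible F E \<Longrightarrow>
    is_chain T0 \<Lambda> T (F # Es) \<Longrightarrow> is_chain T0 \<Lambda> T (E # F # Es)"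

text \<open>\<open>traverse_back T [E\<^sub>0, \<dots>, E\<^sub>K] T'\<close>: the steps \<open>k = K, \<dots>, 1\<close> of the backward traversal turn
  \<open>T\<close> into \<open>T'\<close>. How \<open>E\<^sub>k\<close> (here \<open>F\<close>) is treated depends on its predecessor \<open>E\<^sub>k\<^sub>-\<^sub>1\<close> (here \<open>E\<close>);
  \<open>E\<^sub>0\<close> itself is not bisected yet.\<close>

inductive traverse_back :: "mesh \<Rightarrow> triangle list \<Rightarrow> mesh \<Rightarrow> bool" for T where
  traverse_start: "traverse_back T [E] T"
| traverse_once: "traverse_back T (F # Es) T' \<Longrightarrow> F \<in> T' \<Longrightarrow> compatible F E \<Longrightarrow>
    traverse_back T (E # F # Es) (bisect T' F)"
| traverse_twice: "traverse_back T (F # Es) T' \<Longrightarrow> F \<in> T' \<Longrightarrow> \<not> compatible F E \<Longrightarrow>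
    G \<in> children F \<Longrightarrow> facing (bisect T' F) E G \<Longrightarrow>
    traverse_back T (E # F # Es) (bisect (bisect T' F) G)"

definition create_admissible_chain :: "mesh \<Rightarrow> nat \<Rightarrow> mesh \<Rightarrow> triangle \<Rightarrow> mesh \<Rightarrow> bool" where
  "create_admissible_chain T0 \<Lambda> T E T' \<longleftrightarrow>
     (\<exists>Es S. is_chain T0 \<Lambda> T (E # Es) \<and> traverse_back T (E # Es) S \<and> E \<in> S \<and> T' = bisect S E)"

inductive refine_list :: "mesh \<Rightarrow> nat \<Rightarrow> mesh \<Rightarrow> triangle list \<Rightarrow> mesh \<Rightarrow> bool" for T0 \<Lambda> where
  refine_Nil: "refine_list T0 \<Lambda> T [] T"
| refine_in: "E \<in> T \<Longrightarrow> create_admissible_chain T0 \<Lambda> T E T' \<Longrightarrow> refine_list T0 \<Lambda> T' Es T'' \<Longrightarrow>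
    refine_list T0 \<Lambda> T (E # Es) T''"
| refine_notin: "E \<notin> T \<Longrightarrow> refine_list T0 \<Lambda> T Es T'' \<Longrightarrow> refine_list T0 \<Lambda> T (E # Es) T''"

text \<open>\<open>refine T0 \<Lambda> T M T'\<close>: \<open>T'\<close> is a result of \<open>REFINE(T, M)\<close>, the marked elements being processed
  in an arbitrary order.\<close>

definition refine :: "mesh \<Rightarrow> nat \<Rightarrow> mesh \<Rightarrow> triangle set \<Rightarrow> mesh \<Rightarrow> bool" where
  "refine T0 \<Lambda> T M T' \<longleftrightarrow> (\<exists>Es. distinct Es \<and> set Es = M \<and> refine_list T0 \<Lambda> T Es T')"

end

theory Submission
  imports Defs
begin

text \<open>
  The argument follows Binev, Dahmen and DeVore: every element created by the refinement collects
  charges from the marked elements, it collects at least a fixed amount, and each marked element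
  hands out at most a fixed amount.  Two facts about a single chain started at a marked element
  \<open>E\<close> make this work: an element \<open>X\<close> that it creates has generation (number of bisections
  separating it from its root in the initial mesh) at most one more than \<open>E\<close>, and its distance to
  \<open>E\<close> is at most a constant times \<open>\<sigma> ^ gen X\<close> with \<open>\<sigma> = 1 / sqrt 2\<close>, that is, comparable
  with the size of \<open>X\<close> (\<open>create_admissible_chain_new\<close>).  The constants depend on the
  initial mesh alone, so they are the same for all values of \<open>\<Lambda>\<close>: the index decides how long a
  chain is, but along every chain the generations fall strictly, with the possible exception of its
  last step.

  Why generations fall: choose for each initial triangle a linear map, its chart, sending its two
  legs (the sides at the newest vertex) to the unit vectors of the plane.  In this chart a triangle
  of generation \<open>g\<close> is right isosceles with legs of length \<open>\<sigma> ^ g\<close> (\<open>descendant_frame\<close>).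
  Conformity and suitable labeling say that the charts of two neighbouring initial triangles measure
  their common side alike (\<open>chart_agree_on_common_side\<close>).  If \<open>F\<close> is the facing element of \<open>E\<close>,
  then the hypotenuse of \<open>E\<close> lies inside a side of \<open>F\<close>, and comparing lengths gives
  \<open>gen F \<le> gen E\<close>, with strict inequality when that side is a leg of \<open>F\<close>, that is, when \<open>F\<close> and
  \<open>E\<close> are incompatible (\<open>facing_generation\<close>).  The distance bound is then a geometric sum.

  The marked element \<open>E\<close> hands \<open>\<sigma> ^ gen E / \<sigma> ^ gen X\<close> to an element \<open>X\<close> with
  \<open>gen X \<le> gen E + 1\<close> that is near on the scale of \<open>X\<close>.  Only boundedly many triangles of a given
  generation lie near a given point, because their vertices form a lattice in the chart
  (\<open>forest_near\<close>), so the total handed out by \<open>E\<close> is again a geometric sum (\<open>charge_handed_out_le\<close>).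
  Conversely, starting from \<open>X\<close>, pass repeatedly from an element to the marked element whose chain
  created it.  As generations drop by at most one per step, this walk collects charges until they add
  up to one.  Apart from the first step, whose length is comparable with the size of \<open>X\<close>, the length of
  each step is bounded by the charge collected just before it, so the walk stays near \<open>X\<close> until then
  (\<open>marked_weight\<close>).
\<close>

section \<open>Triangles given by a corner and two legs\<close>

definition det2 :: "point \<Rightarrow> point \<Rightarrow> real" where
  "det2 u v = u $ 1 * v $ 2 - u $ 2 * v $ 1"

definition corner :: "point \<Rightarrow> point \<Rightarrow> point \<Rightarrow> triangle" where
  "corner p u v = Triangle {p, p + u, p + v} p"

lemma nv_corner [simp]: "nv (corner p u v) = p"
  by (simp add: corner_def)

lemma verts_corner [simp]: "verts (corner p u v) = {p, p + u, p + v}"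
  by (simp add: corner_def)

lemma det2_legs:
  assumes "det2 u v \<noteq> 0"
  shows "u \<noteq> 0" "v \<noteq> 0" "u \<noteq> v"
  using assms by (auto simp: det2_def)

text \<open>Cramer's rule.\<close>

lemma det2_expand:
  assumes "det2 u v \<noteq> 0"
  shows "x = (det2 x v / det2 u v) *\<^sub>R u + (det2 u x / det2 u v) *\<^sub>R v"
  using assms by (simp add: vec_eq_iff forall_2 det2_def divide_simps) (simp add: algebra_simps)

lemma det2_coeffs_unique:
  assumes "det2 u v \<noteq> 0" and "a *\<^sub>R u + b *\<^sub>R v = a' *\<^sub>R u + b' *\<^sub>R v"
  shows "a = a' \<and> b = b'"
proof -
  have lin: "det2 (c *\<^sub>R u + d *\<^sub>R v) v = c * det2 u v"
    "det2 u (c *\<^sub>R u + d *\<^sub>R v) = d * det2 u v" for c d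
    by (simp_all add: det2_def algebra_simps)
  show ?thesis
    using lin[of a b] lin[of a' b'] assms by simp
qed

lemma is_triangle_cornerE:
  assumes "is_triangle E"
  obtains u v where "E = corner (nv E) u v" "det2 u v \<noteq> 0"
proof -
  define p where "p = nv E"
  have fin: "finite (verts E)"
    using assms by (metis card.infinite is_triangle_def zero_neq_numeral)
  have "card (verts E - {p}) = 2"
    using assms fin by (simp add: is_triangle_def p_def)
  then obtain a b where ab: "verts E - {p} = {a, b}" "a \<noteq> b"
    by (meson card_2_iff)
  then have V: "verts E = {p, a, b}"
    using assms by (auto simp: is_triangle_def p_def)
  have ne: "a \<noteq> p" "b \<noteq> p"
    using ab by auto
  define u v where "u = a - p" and "v = b - p"
  have E: "E = corner p u v"
    using V by (cases E) (simp add: corner_def u_def v_def p_def)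
  have "det2 u v \<noteq> 0"
  proof
    assume d: "det2 u v = 0"
    have u0: "u \<noteq> 0"
      using ne by (simp add: u_def)
    have "\<exists>c. v = c *\<^sub>R u"
    proof (cases "u $ 1 = 0")
      case True
      then have "u $ 2 \<noteq> 0"
        using u0 by (metis exhaust_2 vec_eq_iff zero_index)
      then show ?thesis
        using d True
        by (intro exI[of _ "v $ 2 / u $ 2"]) (auto simp: vec_eq_iff forall_2 det2_def)
    next
      case False
      then show ?thesis
        using d
        by (intro exI[of _ "v $ 1 / u $ 1"]) (auto simp: vec_eq_iff forall_2 det2_def field_simps)
    qed
    then have "collinear {0, u, v}"
      by (auto simp: collinear_lemma)
    then have "collinear {a, p, b}"
      using collinear_3[of a p b] by (simp add: NO_MATCH_def u_def v_def)
    then show False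
      using assms V by (simp add: is_triangle_def insert_commute)
  qed
  with E show ?thesis
    using that p_def by simp
qed

lemma oe_ends_corner:
  assumes "det2 u v \<noteq> 0"
  shows "oe_ends (corner p u v) = {p + u, p + v}"
  using det2_legs[OF assms] by (auto simp: oe_ends_def)

lemma oe_corner:
  assumes "det2 u v \<noteq> 0"
  shows "oe (corner p u v) = closed_segment (p + u) (p + v)"
  by (simp add: oe_def oe_ends_corner[OF assms] segment_convex_hull)

lemma moe_corner:
  assumes "det2 u v \<noteq> 0"
  shows "moe (corner p u v) = p + (1/2) *\<^sub>R (u + v)"
proof -
  have "p + u \<noteq> p + v"
    using det2_legs[OF assms] by simp
  then show ?thesis
    by (simp add: moe_def oe_ends_corner[OF assms] vec_eq_iff field_simps)
qed

lemma children_corner: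
  assumes "det2 u v \<noteq> 0"
  shows "children (corner p u v) =
    {corner (p + (1/2) *\<^sub>R (u + v)) (- (1/2) *\<^sub>R (u + v)) ((1/2) *\<^sub>R (u - v)),
     corner (p + (1/2) *\<^sub>R (u + v)) (- (1/2) *\<^sub>R (u + v)) ((1/2) *\<^sub>R (v - u))}"
proof -
  have "p + (1/2) *\<^sub>R (u + v) + (- (1/2)) *\<^sub>R (u + v) = p"
    "p + (1/2) *\<^sub>R (u + v) + (1/2) *\<^sub>R (u - v) = p + u"
    "p + (1/2) *\<^sub>R (u + v) + (1/2) *\<^sub>R (v - u) = p + v"
    by (simp_all add: vec_eq_iff field_simps)
  then show ?thesis
    unfolding children_def oe_ends_corner[OF assms] moe_corner[OF assms] nv_corner
    unfolding corner_def by (auto simp: insert_commute)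
qed

lemma region_cornerE:
  assumes "x \<in> region (corner p u v)"
  obtains a b where "0 \<le> a" "0 \<le> b" "a + b \<le> 1" "x = p + a *\<^sub>R u + b *\<^sub>R v"
proof -
  obtain c a b where "0 \<le> c" "0 \<le> a" "0 \<le> b" "c + a + b = 1" and
      x: "x = c *\<^sub>R p + a *\<^sub>R (p + u) + b *\<^sub>R (p + v)"
    using assms by (auto simp: region_def convex_hull_3)
  moreover have "x = (c + a + b) *\<^sub>R p + a *\<^sub>R u + b *\<^sub>R v"
    unfolding x by (simp add: algebra_simps)
  ultimately show ?thesis
    using that[of a b] by simp
qed

lemma region_cornerI:
  assumes "0 \<le> a" "0 \<le> b" "a + b \<le> 1"
  shows "p + a *\<^sub>R u + b *\<^sub>R v \<in> region (corner p u v)"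
proof -
  have "p + a *\<^sub>R u + b *\<^sub>R v = (1 - a - b) *\<^sub>R p + a *\<^sub>R (p + u) + b *\<^sub>R (p + v)"
    by (simp add: algebra_simps)
  then show ?thesis
    using assms unfolding region_def convex_hull_3 verts_corner
    by (intro CollectI exI[of _ "1 - a - b"] exI[of _ a] exI[of _ b]) auto
qed

lemma verts_subset_region: "verts E \<subseteq> region E"
  by (simp add: region_def hull_subset)

lemma child_corner:
  assumes "det2 u v \<noteq> 0" and "C \<in> children (corner p u v)"
  obtains u' v' where "C = corner (p + (1/2) *\<^sub>R (u + v)) u' v'" "det2 u' v' \<noteq> 0"
    "u' = - (1/2) *\<^sub>R (u + v)" "v' = (1/2) *\<^sub>R (u - v) \<or> v' = (1/2) *\<^sub>R (v - u)"
proof -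
  have "det2 (- (1/2) *\<^sub>R (u + v)) ((1/2) *\<^sub>R (u - v)) = det2 u v / 2"
    "det2 (- (1/2) *\<^sub>R (u + v)) ((1/2) *\<^sub>R (v - u)) = - det2 u v / 2"
    by (simp_all add: det2_def field_simps)
  then show ?thesis
    using assms that unfolding children_corner[OF assms(1)] by force
qed

lemma region_child_subset:
  assumes "det2 u v \<noteq> 0" and "C \<in> children (corner p u v)"
  shows "region C \<subseteq> region (corner p u v)"
proof -
  have "p + (1/2) *\<^sub>R (u + v) \<in> region (corner p u v)"
    using region_cornerI[of "1/2" "1/2" p u v] by (simp add: algebra_simps)
  then have "verts C \<subseteq> region (corner p u v)"
    using assms verts_subset_region[of "corner p u v"]
    by (auto simp: children_def oe_ends_corner moe_corner)
  then show ?thesis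
    unfolding region_def[of C]
    by (rule hull_minimal) (simp add: region_def)
qed

section \<open>Descendants and charts\<close>

inductive descendant :: "triangle \<Rightarrow> nat \<Rightarrow> triangle \<Rightarrow> bool" for R where
  descendant_refl: "descendant R 0 R"
| descendant_child: "descendant R g E \<Longrightarrow> C \<in> children E \<Longrightarrow> descendant R (Suc g) C"

text \<open>A chart identifies the directions of \<open>R\<close> with those of the right isosceles triangle whose legs are
  the unit vectors.  Keeping only the linear part suffices to measure lengths of sides, and positions
  are measured relative to \<open>nv R\<close>.\<close>

definition chart :: "triangle \<Rightarrow> (point \<Rightarrow> point) \<Rightarrow> bool" where
  "chart R L \<longleftrightarrow> linear L \<and> inj L \<and>
     (\<exists>u v. det2 u v \<noteq> 0 \<and> R = corner (nv R) u v \<and> L u = axis 1 1 \<and> L v = axis 2 1)"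

lemma chart_exists:
  assumes "is_triangle R"
  shows "\<exists>L. chart R L"
proof -
  obtain u v where uv: "R = corner (nv R) u v" "det2 u v \<noteq> 0"
    using assms by (rule is_triangle_cornerE)
  define L :: "point \<Rightarrow> point" where
    "L x = (det2 x v / det2 u v) *\<^sub>R axis 1 1 + (det2 u x / det2 u v) *\<^sub>R axis 2 1" for x
  have L12: "L x $ 1 = det2 x v / det2 u v" "L x $ 2 = det2 u x / det2 u v" for x
    by (simp_all add: L_def axis_def)
  have "linear L"
    by (rule linearI) (simp_all add: vec_eq_iff forall_2 L12 det2_def add_divide_distrib[symmetric]
        algebra_simps)
  moreover have "inj L"
  proof (rule injI)
    fix x y assume "L x = L y"
    then show "x = y"
      using det2_expand[OF uv(2), of x] det2_expand[OF uv(2), of y] L12 by metis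
  qed
  moreover have "L u = axis 1 1" "L v = axis 2 1"
    using uv(2) by (simp_all add: L_def det2_def)
  ultimately show ?thesis
    using uv unfolding chart_def by blast
qed

text \<open>One bisection scales a right isosceles triangle by this factor.\<close>

definition \<sigma> :: real where "\<sigma> = 1 / sqrt 2"

lemma \<sigma>_bounds: "0 < \<sigma>" "\<sigma> < 1"
  by (simp_all add: \<sigma>_def)

lemma \<sigma>_sq: "\<sigma>\<^sup>2 = 1 / 2"
  by (simp add: \<sigma>_def power_divide)

lemma \<sigma>_mono: "m \<le> n \<Longrightarrow> \<sigma> ^ n \<le> \<sigma> ^ m"
  using \<sigma>_bounds by (intro power_decreasing) auto

lemma \<sigma>_le_iff: "\<sigma> ^ n \<le> \<sigma> ^ m \<longleftrightarrow> m \<le> n"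
  using \<sigma>_bounds by (simp add: power_decreasing_iff)

text \<open>The legs of a child are half the sum and half the difference of the legs of its parent; both are
  half diagonals of a square.\<close>

lemma norm_half_sum_orthogonal:
  fixes a b :: "'a::real_inner"
  assumes "norm a = r" "norm b = r" "a \<bullet> b = 0"
  shows "norm ((1/2) *\<^sub>R (a + b)) = \<sigma> * r" "norm ((1/2) *\<^sub>R (a - b)) = \<sigma> * r"
proof -
  have r: "r \<ge> 0" "a \<bullet> a = r\<^sup>2" "b \<bullet> b = r\<^sup>2"
    using assms by (auto simp: dot_square_norm)
  have "(norm ((1/2) *\<^sub>R (a + b)))\<^sup>2 = (\<sigma> * r)\<^sup>2" "(norm ((1/2) *\<^sub>R (a - b)))\<^sup>2 = (\<sigma> * r)\<^sup>2"
    using assms(3) r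
    by (simp_all add: power_mult_distrib \<sigma>_sq dot_square_norm[symmetric] inner_add_left inner_add_right
        inner_diff_left inner_diff_right inner_commute[of b a] del: norm_scaleR)
  moreover have "\<sigma> * r \<ge> 0"
    using r \<sigma>_bounds by simp
  ultimately show "norm ((1/2) *\<^sub>R (a + b)) = \<sigma> * r" "norm ((1/2) *\<^sub>R (a - b)) = \<sigma> * r"
    using power2_eq_imp_eq norm_ge_zero by blast+
qed

text \<open>In the chart of its root, every descendant is a right isosceles triangle, as bisecting such a
  triangle from its right angle gives two such triangles.  Hence the chart turns generations into
  lengths.\<close>

lemma descendant_frame:
  assumes "chart R L" and "descendant R g E"
  shows "\<exists>p u v. E = corner p u v \<and> det2 u v \<noteq> 0 \<and>
           norm (L u) = \<sigma> ^ g \<and> norm (L v) = \<sigma> ^ g \<and> L u \<bullet> L v = 0"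
  using assms(2)
proof induction
  case descendant_refl
  from assms(1) obtain u v where "det2 u v \<noteq> 0" "R = corner (nv R) u v"
      "L u = axis 1 1" "L v = axis 2 1"
    unfolding chart_def by blast
  moreover have "axis 1 1 \<bullet> (axis 2 1 :: point) = 0"
    by (simp add: inner_axis_axis)
  ultimately show ?case
    by (metis norm_axis_1 power_0)
next
  case (descendant_child g E C)
  then obtain p u v where E: "E = corner p u v" "det2 u v \<noteq> 0"
      and L: "norm (L u) = \<sigma> ^ g" "norm (L v) = \<sigma> ^ g" "L u \<bullet> L v = 0"
    by blast
  from E descendant_child.hyps obtain u' v' where C: "C = corner (p + (1/2) *\<^sub>R (u + v)) u' v'"
      "det2 u' v' \<noteq> 0" "u' = - (1/2) *\<^sub>R (u + v)" "v' = (1/2) *\<^sub>R (u - v) \<or> v' = (1/2) *\<^sub>R (v - u)"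
    using child_corner by metis
  have lin: "linear L"
    using assms(1) by (simp add: chart_def)
  have Lu': "L u' = - ((1/2) *\<^sub>R (L u + L v))"
    unfolding C(3) by (simp add: linear_scale[OF lin] linear_add[OF lin] linear_neg[OF lin])
  have Lv': "L v' = (1/2) *\<^sub>R (L u - L v) \<or> L v' = - ((1/2) *\<^sub>R (L u - L v))"
  proof -
    have "L ((1/2) *\<^sub>R (x - y)) = (1/2) *\<^sub>R (L x - L y)" for x y
      by (simp add: linear_scale[OF lin] linear_diff[OF lin])
    moreover have "(1/2) *\<^sub>R (L v - L u) = - ((1/2) *\<^sub>R (L u - L v))"
      by (simp only: scaleR_minus_right[symmetric] minus_diff_eq)
    ultimately show ?thesis
      using C(4) by metis
  qed
  have "norm (L u') = \<sigma> * \<sigma> ^ g"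
    unfolding Lu' norm_minus_cancel using norm_half_sum_orthogonal(1)[OF L] .
  moreover have "norm (L v') = \<sigma> * \<sigma> ^ g"
    using Lv' norm_half_sum_orthogonal(2)[OF L] by (metis norm_minus_cancel)
  moreover have "(L u + L v) \<bullet> (L u - L v) = 0"
    using L by (simp add: inner_add_left inner_diff_right dot_square_norm inner_commute[of "L v"])
  then have "L u' \<bullet> L v' = 0"
    using Lv' unfolding Lu' by (elim disjE) simp_all
  ultimately show ?case
    using C(1,2) by (metis power_Suc)
qed

lemma norm_opposite_side:
  assumes "linear L" "norm (L u) = r" "norm (L v) = r" "L u \<bullet> L v = 0"
  shows "norm (L (u - v)) = sqrt 2 * r"
proof -
  have "norm (L (u - v)) = 2 * norm ((1/2) *\<^sub>R (L u - L v))"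
    by (simp add: linear_diff[OF assms(1)])
  also have "\<dots> = 2 * \<sigma> * r"
    using norm_half_sum_orthogonal(2)[OF assms(2-)] by simp
  also have "2 * \<sigma> = sqrt 2"
    by (simp add: \<sigma>_def real_div_sqrt)
  finally show ?thesis .
qed

lemma descendant_region_subset:
  assumes "is_triangle R" and "descendant R g E"
  shows "region E \<subseteq> region R"
  using assms(2)
proof induction
  case (descendant_child g E C)
  then show ?case
    using region_child_subset descendant_frame chart_exists[OF assms(1)]
    by (metis (full_types) subset_trans)
qed simp

section \<open>Facing elements\<close>

text \<open>If the side opposite to the newest vertex of one triangle is the whole intersection with another
  triangle, then it lies in one side of the other triangle.  Otherwise its midpoint would be interior
  to the other triangle, and moving from it slightly towards the newest vertex \<open>p\<close> would lead to a
  common point off the segment.\<close>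

lemma oe_inside_a_side:
  assumes d: "det2 u v \<noteq> 0" and d': "det2 s t \<noteq> 0"
    and cap: "region (corner p u v) \<inter> region (corner q s t) = closed_segment (p + u) (p + v)"
    and a: "p + u = q + a1 *\<^sub>R s + b1 *\<^sub>R t" "0 \<le> a1" "0 \<le> b1" "a1 + b1 \<le> 1"
    and b: "p + v = q + a2 *\<^sub>R s + b2 *\<^sub>R t" "0 \<le> a2" "0 \<le> b2" "a2 + b2 \<le> 1"
  shows "a1 = 0 \<and> a2 = 0 \<or> b1 = 0 \<and> b2 = 0 \<or> a1 + b1 = 1 \<and> a2 + b2 = 1"
proof (rule ccontr)
  assume not_side: "\<not> (a1 = 0 \<and> a2 = 0 \<or> b1 = 0 \<and> b2 = 0 \<or> a1 + b1 = 1 \<and> a2 + b2 = 1)"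
  define \<alpha> \<beta> where "\<alpha> = (a1 + a2) / 2" and "\<beta> = (b1 + b2) / 2"
  have ab: "0 < \<alpha>" "0 < \<beta>" "\<alpha> + \<beta> < 1"
  proof -
    have "0 \<le> \<alpha>" "0 \<le> \<beta>" "\<alpha> + \<beta> \<le> 1"
      using a(2-) b(2-) by (simp_all add: \<alpha>_def \<beta>_def field_simps)
    moreover have "\<alpha> \<noteq> 0" "\<beta> \<noteq> 0" "\<alpha> + \<beta> \<noteq> 1"
      using not_side a(2-) b(2-) unfolding \<alpha>_def \<beta>_def by argo+
    ultimately show "0 < \<alpha>" "0 < \<beta>" "\<alpha> + \<beta> < 1"
      by simp_all
  qed
  \<comment> \<open>The midpoint has coordinates \<open>(1/2, 1/2)\<close> in one triangle and \<open>(\<alpha>, \<beta>)\<close> in the other.\<close>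
  define m where "m = p + (1/2) *\<^sub>R (u + v)"
  have m: "m = q + \<alpha> *\<^sub>R s + \<beta> *\<^sub>R t"
  proof -
    have "m = (1/2) *\<^sub>R ((p + u) + (p + v))"
      by (simp add: m_def vec_eq_iff field_simps)
    also have "\<dots> = q + \<alpha> *\<^sub>R s + \<beta> *\<^sub>R t"
      unfolding a(1) b(1) \<alpha>_def \<beta>_def by (simp add: vec_eq_iff field_simps)
    finally show ?thesis .
  qed
  define x y where "x = det2 (p - q) t / det2 s t" and "y = det2 s (p - q) / det2 s t"
  have p: "p = q + x *\<^sub>R s + y *\<^sub>R t"
    using det2_expand[OF d', of "p - q"] by (simp add: x_def y_def algebra_simps)
  have "\<forall>\<^sub>F e in at_right (0::real). 0 < \<alpha> + e * (x - \<alpha>)"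
       "\<forall>\<^sub>F e in at_right (0::real). 0 < \<beta> + e * (y - \<beta>)"
       "\<forall>\<^sub>F e in at_right (0::real). \<alpha> + \<beta> + e * (x + y - \<alpha> - \<beta>) < 1"
    by (rule order_tendstoD[where f="\<lambda>e. _ + e * _"], (intro tendsto_eq_intros | simp add: ab)+)+
  moreover have "\<forall>\<^sub>F e in at_right (0::real). 0 < e \<and> e < 1"
    by (auto intro!: eventually_at_right_real[THEN eventually_mono])
  ultimately have "\<forall>\<^sub>F e in at_right (0::real). 0 < \<alpha> + e * (x - \<alpha>) \<and> 0 < \<beta> + e * (y - \<beta>) \<and>
      \<alpha> + \<beta> + e * (x + y - \<alpha> - \<beta>) < 1 \<and> 0 < e \<and> e < 1"
    by eventually_elim auto
  then obtain e where e: "0 < \<alpha> + e * (x - \<alpha>)" "0 < \<beta> + e * (y - \<beta>)"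
      "\<alpha> + \<beta> + e * (x + y - \<alpha> - \<beta>) < 1" "0 < e" "e < 1"
    using eventually_happens'[OF trivial_limit_at_right_real] by blast
  define z where "z = m + e *\<^sub>R (p - m)"
  have "z = q + (\<alpha> + e * (x - \<alpha>)) *\<^sub>R s + (\<beta> + e * (y - \<beta>)) *\<^sub>R t"
    unfolding z_def p m by (simp add: vec_eq_iff algebra_simps)
  also have "\<dots> \<in> region (corner q s t)"
    using e by (intro region_cornerI) (auto simp: algebra_simps)
  finally have "z \<in> region (corner q s t)" .
  moreover have z: "z = p + ((1 - e) / 2) *\<^sub>R u + ((1 - e) / 2) *\<^sub>R v"
    unfolding z_def m_def by (simp add: vec_eq_iff field_simps)
  then have "z \<in> region (corner p u v)"
    using e region_cornerI[of "(1 - e) / 2" "(1 - e) / 2" p u v] by simp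
  ultimately have "z \<in> closed_segment (p + u) (p + v)"
    using cap by blast
  then obtain c where "z = (1 - c) *\<^sub>R (p + u) + c *\<^sub>R (p + v)"
    by (auto simp: in_segment)
  then have "((1 - e) / 2) *\<^sub>R u + ((1 - e) / 2) *\<^sub>R v = (1 - c) *\<^sub>R u + c *\<^sub>R v"
    using z by (simp add: vec_eq_iff algebra_simps)
  then have "(1 - e) / 2 = 1 - c \<and> (1 - e) / 2 = c"
    using det2_coeffs_unique[OF d] by blast
  then show False
    using e by (auto simp: field_simps)
qed

lemma corner_notin_line:
  assumes d: "det2 u v \<noteq> 0" and "a1 + b1 = 1" "a2 + b2 = 1"
  shows "p \<notin> affine hull {p + a1 *\<^sub>R u + b1 *\<^sub>R v, p + a2 *\<^sub>R u + b2 *\<^sub>R v}"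
proof
  assume "p \<in> affine hull {p + a1 *\<^sub>R u + b1 *\<^sub>R v, p + a2 *\<^sub>R u + b2 *\<^sub>R v}"
  then obtain x y where xy: "x + y = 1"
      "p = x *\<^sub>R (p + a1 *\<^sub>R u + b1 *\<^sub>R v) + y *\<^sub>R (p + a2 *\<^sub>R u + b2 *\<^sub>R v)"
    by (auto simp: affine_hull_2)
  have "p = (x + y) *\<^sub>R p + ((x * a1 + y * a2) *\<^sub>R u + (x * b1 + y * b2) *\<^sub>R v)"
    by (subst xy(2)) (simp add: algebra_simps)
  then have "(x * a1 + y * a2) *\<^sub>R u + (x * b1 + y * b2) *\<^sub>R v = 0 *\<^sub>R u + 0 *\<^sub>R v"
    using xy(1) by simp
  then have "x * a1 + y * a2 = 0 \<and> x * b1 + y * b2 = 0"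
    by (rule det2_coeffs_unique[OF d])
  then have "x * (a1 + b1) + y * (a2 + b2) = 0"
    by (simp add: algebra_simps)
  then show False
    using assms xy by simp
qed

text \<open>The side of the facing element that contains the hypotenuse of the given element decides about
  compatibility: if it is the hypotenuse \<open>s - t\<close>, then neither newest vertex is on its line.\<close>

lemma facing_cases:
  assumes d: "det2 u v \<noteq> 0" and d': "det2 s t \<noteq> 0"
    and fac: "facing T (corner p u v) (corner q s t)"
  shows "(\<exists>c. \<bar>c\<bar> \<le> 1 \<and> (u - v = c *\<^sub>R s \<or> u - v = c *\<^sub>R t)) \<or>
    (\<exists>c. \<bar>c\<bar> \<le> 1 \<and> u - v = c *\<^sub>R (s - t)) \<and> compatible (corner q s t) (corner p u v)"
proof -
  have cap: "region (corner p u v) \<inter> region (corner q s t) = closed_segment (p + u) (p + v)"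
    using fac by (simp add: facing_def oe_corner[OF d])
  then have "p + u \<in> region (corner q s t)" "p + v \<in> region (corner q s t)"
    by blast+
  then obtain a1 b1 a2 b2 where
    a: "p + u = q + a1 *\<^sub>R s + b1 *\<^sub>R t" "0 \<le> a1" "0 \<le> b1" "a1 + b1 \<le> 1"
    and b: "p + v = q + a2 *\<^sub>R s + b2 *\<^sub>R t" "0 \<le> a2" "0 \<le> b2" "a2 + b2 \<le> 1"
    by (metis region_cornerE)
  have uv: "u - v = (a1 - a2) *\<^sub>R s + (b1 - b2) *\<^sub>R t"
  proof -
    have "u - v = (p + u) - (p + v)"
      by simp
    then show ?thesis
      unfolding a(1) b(1) by (simp add: algebra_simps)
  qed
  consider "a1 = 0 \<and> a2 = 0" | "b1 = 0 \<and> b2 = 0" | "a1 + b1 = 1 \<and> a2 + b2 = 1"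
    using oe_inside_a_side[OF d d' cap a b] by blast
  then show ?thesis
  proof cases
    case 1
    then have "u - v = (b1 - b2) *\<^sub>R t" "\<bar>b1 - b2\<bar> \<le> 1"
      using uv a b by auto
    then show ?thesis
      by blast
  next
    case 2
    then have "u - v = (a1 - a2) *\<^sub>R s" "\<bar>a1 - a2\<bar> \<le> 1"
      using uv a b by auto
    then show ?thesis
      by blast
  next
    case 3
    then have "b1 - b2 = - (a1 - a2)"
      by simp
    then have "u - v = (a1 - a2) *\<^sub>R s + (- (a1 - a2)) *\<^sub>R t"
      using uv by simp
    then have "u - v = (a1 - a2) *\<^sub>R (s - t)" "\<bar>a1 - a2\<bar> \<le> 1"
      using 3 a(2-) b(2-) by (auto simp: scaleR_right_diff_distrib simp del: minus_diff_eq)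
    moreover have "affine hull closed_segment (p + u) (p + v) = affine hull {p + u, p + v}"
      by (simp add: segment_convex_hull affine_hull_convex_hull)
    moreover have "p \<notin> affine hull {p + u, p + v}"
      using corner_notin_line[OF d, of 1 0 0 1 p] by simp
    moreover have "q \<notin> affine hull {p + u, p + v}"
      unfolding a(1) b(1) using corner_notin_line[OF d'] 3 by blast
    moreover have "closed_segment (p + u) (p + v) \<in> sides (corner p u v)"
      unfolding sides_def using det2_legs[OF d] by fastforce
    ultimately show ?thesis
      using cap by (auto simp: compatible_def adjacent_def Int_commute)
  qed
qed

text \<open>By conformity the two roots share exactly one side.  Its length in a chart is \<open>sqrt 2\<close> or \<open>1\<close>
  according to whether it is opposite to the newest vertex, and suitable labeling makes the answer
  the same for both roots.  The charts may still disagree in all other directions.\<close>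

lemma chart_agree_on_common_side:
  assumes conf: "conforming_triangulation D T0" and suit: "suitable_labeling T0"
    and R: "R \<in> T0" "R' \<in> T0" "R \<noteq> R'"
    and ch: "chart R L" "chart R' L'"
    and xy: "x \<noteq> y" "x \<in> region R \<inter> region R'" "y \<in> region R \<inter> region R'"
  shows "norm (L (x - y)) = norm (L' (x - y))"
proof -
  have side_length: "norm (K (c - d)) = (if closed_segment c d = oe Q then sqrt 2 else 1)"
    if K: "chart Q K" and cd: "c \<in> verts Q" "d \<in> verts Q" "c \<noteq> d" for Q K c d
  proof -
    from K obtain u v where uv: "det2 u v \<noteq> 0" "Q = corner (nv Q) u v" "K u = axis 1 1"
        "K v = axis 2 1" and lin: "linear K"
      unfolding chart_def by blast
    have n: "norm (K u) = 1" "norm (K v) = 1" "norm (K (u - v)) = sqrt 2" "norm (K (v - u)) = sqrt 2"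
      using norm_opposite_side[OF lin, of u 1 v] uv
      by (simp_all add: inner_axis_axis linear_diff[OF lin] norm_minus_commute)
    then have m: "norm (K (- u)) = 1" "norm (K (- v)) = 1"
      by (simp_all add: linear_neg[OF lin])
    have oe: "oe Q = closed_segment (nv Q + u) (nv Q + v)"
      using oe_corner[OF uv(1)] uv(2) by metis
    have "verts Q = {nv Q, nv Q + u, nv Q + v}"
      using uv(2) verts_corner by metis
    then show ?thesis
      using cd n m det2_legs[OF uv(1)]
      by (auto simp: oe closed_segment_eq doubleton_eq_iff)
  qed
  have "region R \<inter> region R' \<in> sides R \<inter> sides R'"
  proof -
    have "region R \<inter> region R' = {} \<or> (\<exists>z\<in>verts R \<inter> verts R'. region R \<inter> region R' = {z}) \<or>
        region R \<inter> region R' \<in> sides R \<inter> sides R'"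
      using conf R unfolding conforming_triangulation_def by metis
    then show ?thesis
      using xy by (metis empty_iff singletonD)
  qed
  then have "region R \<inter> region R' \<in> sides R" "region R \<inter> region R' \<in> sides R'"
    by blast+
  then obtain c d c' d' where cd: "region R \<inter> region R' = closed_segment c d"
      "c \<in> verts R" "d \<in> verts R" "c \<noteq> d"
      and cd': "region R \<inter> region R' = closed_segment c' d'" "c' \<in> verts R'" "d' \<in> verts R'"
    unfolding sides_def by blast
  from cd(1) cd' have cdR': "c \<in> verts R'" "d \<in> verts R'"
    by (auto simp: closed_segment_eq doubleton_eq_iff)
  have "closed_segment c d \<in> sides R \<inter> sides R'"
    using cd cdR' by (auto simp: sides_def)
  then have "closed_segment c d = oe R \<longleftrightarrow> closed_segment c d = oe R'"
    using suit R unfolding suitable_labeling_def by blast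
  then have eq: "norm (L (c - d)) = norm (L' (c - d))"
    using side_length[OF ch(1) cd(2-4)] side_length[OF ch(2) cdR' cd(4)] by simp
  obtain a b where ab: "x = (1 - a) *\<^sub>R c + a *\<^sub>R d" "y = (1 - b) *\<^sub>R c + b *\<^sub>R d"
    using xy cd(1) by (metis in_segment(1))
  have "x - y = (b - a) *\<^sub>R (c - d)"
    unfolding ab by (simp add: algebra_simps)
  then show ?thesis
    using eq ch by (simp add: chart_def linear_scale)
qed

text \<open>The hypotenuse of \<open>E\<close> has length \<open>sqrt 2 * \<sigma> ^ g\<close> in either chart and is part of a side of \<open>F\<close>,
  whose length is \<open>sqrt 2 * \<sigma> ^ f\<close> for the hypotenuse and \<open>\<sigma> ^ f = sqrt 2 * \<sigma> ^ Suc f\<close> for a leg.\<close>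

lemma facing_generation:
  assumes conf: "conforming_triangulation D T0" and suit: "suitable_labeling T0"
    and R: "R \<in> T0" "R' \<in> T0"
    and E: "descendant R g E" and F: "descendant R' f F" and fac: "facing T E F"
  shows "f \<le> g" and "\<not> compatible F E \<Longrightarrow> f < g"
proof -
  have tri: "is_triangle R" "is_triangle R'"
    using conf R by (auto simp: conforming_triangulation_def)
  obtain K where K: "chart R K"
    using chart_exists tri by blast
  obtain L' where L': "chart R' L'" "R = R' \<Longrightarrow> K = L'"
    using chart_exists tri(2) K by blast
  obtain p u v where puv: "E = corner p u v" "det2 u v \<noteq> 0" "norm (K u) = \<sigma> ^ g"
      "norm (K v) = \<sigma> ^ g" "K u \<bullet> K v = 0"
    using descendant_frame[OF K E] by blast
  obtain q s t where qst: "F = corner q s t" "det2 s t \<noteq> 0" "norm (L' s) = \<sigma> ^ f"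
      "norm (L' t) = \<sigma> ^ f" "L' s \<bullet> L' t = 0"
    using descendant_frame[OF L'(1) F] by blast
  have lin: "linear K" "linear L'"
    using K L' by (auto simp: chart_def)
  have "region E \<inter> region F = closed_segment (p + u) (p + v)"
    using fac puv by (simp add: facing_def oe_corner)
  then have "closed_segment (p + u) (p + v) \<subseteq> region R \<inter> region R'"
    using descendant_region_subset[OF tri(1) E] descendant_region_subset[OF tri(2) F] by blast
  then have "p + u \<in> region R \<inter> region R'" "p + v \<in> region R \<inter> region R'"
    by auto
  moreover have "p + u \<noteq> p + v" "(p + u) - (p + v) = u - v"
    using det2_legs[OF puv(2)] by simp_all
  ultimately have "norm (K (u - v)) = norm (L' (u - v))"
    using chart_agree_on_common_side[OF conf suit R _ K L'(1)] L'(2) by metis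
  then have len: "norm (L' (u - v)) = sqrt 2 * \<sigma> ^ g"
    using norm_opposite_side[OF lin(1) puv(3-5)] by simp
  have scaled: "norm (L' (c *\<^sub>R w)) \<le> norm (L' w)" if "\<bar>c\<bar> \<le> 1" for c w
    using that mult_right_mono[of "\<bar>c\<bar>" 1 "norm (L' w)"] by (simp add: linear_scale[OF lin(2)])
  have leg: "f < g" if "norm (L' (u - v)) \<le> \<sigma> ^ f"
  proof -
    have "\<sigma> ^ g = \<sigma> * (sqrt 2 * \<sigma> ^ g)"
      by (simp add: \<sigma>_def)
    also have "\<dots> \<le> \<sigma> * \<sigma> ^ f"
      using that len \<sigma>_bounds by (intro mult_left_mono) auto
    finally have "\<sigma> ^ g \<le> \<sigma> ^ Suc f"
      by simp
    then show ?thesis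
      by (simp only: \<sigma>_le_iff Suc_le_eq)
  qed
  have opp: "f \<le> g" if "norm (L' (u - v)) \<le> norm (L' (s - t))"
    using that len norm_opposite_side[OF lin(2) qst(3-5)] by (simp add: \<sigma>_le_iff)
  have "facing T (corner p u v) (corner q s t)"
    using fac puv(1) qst(1) by simp
  from facing_cases[OF puv(2) qst(2) this]
  have "norm (L' (u - v)) \<le> \<sigma> ^ f \<or> norm (L' (u - v)) \<le> norm (L' (s - t)) \<and> compatible F E"
  proof (elim disjE exE conjE)
    fix c assume "\<bar>c\<bar> \<le> 1" "u - v = c *\<^sub>R s"
    then show ?thesis
      using scaled[of c s] qst(3) by simp
  next
    fix c assume "\<bar>c\<bar> \<le> 1" "u - v = c *\<^sub>R t"
    then show ?thesis
      using scaled[of c t] qst(4) by simp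
  next
    fix c assume "\<bar>c\<bar> \<le> 1" "u - v = c *\<^sub>R (s - t)" "compatible (corner q s t) (corner p u v)"
    then show ?thesis
      using scaled[of c "s - t"] qst(1) puv(1) by simp
  qed
  then show "f \<le> g" "\<not> compatible F E \<Longrightarrow> f < g"
    using leg opp by auto
qed

section \<open>Counting vertices and triangles near a point\<close>

lemma descendant_leg_norm:
  assumes "chart R L" "descendant R g E" "x \<in> oe_ends E"
  shows "norm (L (x - nv E)) = \<sigma> ^ g"
  using descendant_frame[OF assms(1,2)] assms(3) by (auto simp: oe_ends_corner)

text \<open>With \<open>nv R\<close> as origin, the chart turns these points into a square lattice of width
  \<open>1 / 2 ^ m\<close>.\<close>

definition lattice_point :: "triangle \<Rightarrow> (point \<Rightarrow> point) \<Rightarrow> nat \<Rightarrow> point \<Rightarrow> bool" where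
  "lattice_point R L m x \<longleftrightarrow> (\<forall>i. 2 ^ m * L (x - nv R) $ i \<in> \<int>)"

lemma lattice_point_mono:
  assumes "lattice_point R L m x" "m \<le> n"
  shows "lattice_point R L n x"
proof -
  have "2 ^ n * L (x - nv R) $ i = 2 ^ (n - m) * (2 ^ m * L (x - nv R) $ i)" for i
  proof -
    have "(2::real) ^ n = 2 ^ (n - m) * 2 ^ m"
      using assms(2) by (simp flip: power_add)
    then show ?thesis
      by (simp only: mult.assoc)
  qed
  then show ?thesis
    using assms(1) by (simp only: lattice_point_def) auto
qed

lemma lattice_point_midpoint:
  assumes "linear L" "lattice_point R L m x" "lattice_point R L m y"
  shows "lattice_point R L (Suc m) ((1/2) *\<^sub>R (x + y))"
proof -
  have "(1/2) *\<^sub>R (x + y) - nv R = (1/2) *\<^sub>R ((x - nv R) + (y - nv R))"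
    by (simp add: vec_eq_iff field_simps)
  then have "L ((1/2) *\<^sub>R (x + y) - nv R) = (1/2) *\<^sub>R (L (x - nv R) + L (y - nv R))"
    by (simp only: linear_scale[OF assms(1)] linear_add[OF assms(1)])
  then have "2 ^ Suc m * L ((1/2) *\<^sub>R (x + y) - nv R) $ i =
      2 ^ m * L (x - nv R) $ i + 2 ^ m * L (y - nv R) $ i" for i
    by (simp add: algebra_simps)
  then show ?thesis
    using assms(2,3) by (simp add: lattice_point_def)
qed

text \<open>Two bisections halve the legs, so the mesh width of the lattice need only be halved every second
  generation.  This works because bisection produces midpoints of the side opposite to the newest
  vertex only, and the ends of that side belong to a coarser lattice than the newest vertex
  in odd generations.\<close>

lemma descendant_lattice:
  assumes "chart R L" and "descendant R g E"
  shows "(\<forall>x \<in> verts E. lattice_point R L (Suc g div 2) x) \<and>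
         (\<forall>x \<in> oe_ends E. lattice_point R L (g div 2) x)"
  using assms(2)
proof induction
  case descendant_refl
  from assms(1) obtain u v where uv: "det2 u v \<noteq> 0" "R = corner (nv R) u v"
      "L u = axis 1 1" "L v = axis 2 1" and lin: "linear L"
    unfolding chart_def by blast
  have V: "verts R = {nv R, nv R + u, nv R + v}"
    using uv(2) verts_corner by metis
  then show ?case
    using uv linear_0[OF lin] by (auto simp: lattice_point_def oe_ends_def axis_def)
next
  case (descendant_child g E C)
  then obtain p u v where E: "E = corner p u v" "det2 u v \<noteq> 0"
    using descendant_frame[OF assms(1)] by blast
  have lin: "linear L"
    using assms(1) by (simp add: chart_def)
  have "moe E = (1/2) *\<^sub>R ((p + u) + (p + v))"
    by (simp add: E moe_corner vec_eq_iff field_simps)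
  moreover have "lattice_point R L (g div 2) (p + u)" "lattice_point R L (g div 2) (p + v)"
    using descendant_child.IH by (auto simp: E oe_ends_corner)
  ultimately have m: "lattice_point R L (Suc (g div 2)) (moe E)"
    using lattice_point_midpoint[OF lin] by metis
  obtain a where a: "a \<in> oe_ends E" "C = Triangle {nv E, moe E, a} (moe E)"
    using descendant_child.hyps by (auto simp: children_def)
  have "nv E \<in> verts E" "a \<in> verts E"
    using a(1) by (auto simp: E oe_ends_def)
  then have old: "lattice_point R L (Suc g div 2) (nv E)" "lattice_point R L (Suc g div 2) a"
    using descendant_child.IH by auto
  moreover have "lattice_point R L (Suc (g div 2)) (nv E)" "lattice_point R L (Suc (g div 2)) a"
    using old by (auto elim!: lattice_point_mono)
  ultimately show ?case
    using m a(2) by (auto simp: oe_ends_def)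
qed

lemma power_2_\<sigma>_le: "2 ^ (Suc g div 2) * \<sigma> ^ g \<le> 2"
proof -
  define m where "m = Suc g div 2"
  have "\<sigma> ^ Suc g \<le> \<sigma> ^ (2 * m)"
    by (rule \<sigma>_mono) (simp add: m_def)
  also have "\<dots> = (1/2) ^ m"
    by (simp add: power_mult \<sigma>_sq)
  finally have "2 ^ m * \<sigma> ^ Suc g \<le> 2 ^ m * (1/2) ^ m"
    by (intro mult_left_mono) auto
  then have "2 ^ m * \<sigma> ^ g * \<sigma> \<le> 1"
    by (simp add: power_divide mult_ac)
  then have "2 ^ m * \<sigma> ^ g \<le> sqrt 2"
    by (simp add: \<sigma>_def field_simps)
  also have "\<dots> \<le> 2"
    by (rule real_le_lsqrt) auto
  finally show ?thesis
    by (simp add: m_def)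
qed

lemma card_integers_near:
  fixes c w :: real
  assumes "0 \<le> w"
  shows "real (card {\<lfloor>c - w\<rfloor>..\<lfloor>c + w\<rfloor>}) \<le> 2 * w + 2"
proof -
  have "\<lfloor>c - w\<rfloor> \<le> \<lfloor>c + w\<rfloor>"
    using assms by (intro floor_mono) simp
  then have "real (card {\<lfloor>c - w\<rfloor>..\<lfloor>c + w\<rfloor>}) = of_int (\<lfloor>c + w\<rfloor> - \<lfloor>c - w\<rfloor> + 1)"
    by simp
  then show ?thesis
    by simp linarith
qed

text \<open>In generation \<open>g\<close> the radius and the width of the lattice are both comparable with \<open>\<sigma> ^ g\<close>, so
  the bound does not depend on \<open>g\<close>.\<close>

lemma lattice_points_near:
  assumes "chart R L" and "0 < r"
  shows "\<exists>N. \<forall>g z. finite {x. lattice_point R L (Suc g div 2) x \<and> dist x z \<le> r * \<sigma> ^ g} \<and>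
           card {x. lattice_point R L (Suc g div 2) x \<and> dist x z \<le> r * \<sigma> ^ g} \<le> N"
proof -
  have lin: "linear L" and "inj L"
    using assms(1) by (auto simp: chart_def)
  obtain K where K: "0 < K" "\<And>x. norm (L x) \<le> K * norm x"
    using linear_bounded_pos[OF lin] by blast
  define w where "w = 2 * K * r"
  have w: "0 \<le> w"
    using K(1) assms(2) by (simp add: w_def)
  define N where "N = nat \<lceil>2 * w + 2\<rceil> * nat \<lceil>2 * w + 2\<rceil>"
  have "finite P \<and> card P \<le> N"
    if P: "P = {x. lattice_point R L (Suc g div 2) x \<and> dist x z \<le> r * \<sigma> ^ g}" for P g z
  proof -
    define m where "m = Suc g div 2"
    define c where "c x i = 2 ^ m * L (x - nv R) $ i" for x i
    have near: "\<bar>c x i - c z i\<bar> \<le> w" if "x \<in> P" for x i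
    proof -
      have "L (x - nv R) - L (z - nv R) = L (x - z)"
        by (simp add: linear_diff[OF lin])
      then have "c x i - c z i = 2 ^ m * L (x - z) $ i"
        unfolding c_def by (metis right_diff_distrib vector_minus_component)
      then have "\<bar>c x i - c z i\<bar> = 2 ^ m * \<bar>L (x - z) $ i\<bar>"
        by (simp add: abs_mult)
      also have "\<dots> \<le> 2 ^ m * (K * norm (x - z))"
        using K(2)[of "x - z"] component_le_norm_cart[of "L (x - z)" i]
        by (intro mult_left_mono) auto
      also have "\<dots> \<le> 2 ^ m * (K * (r * \<sigma> ^ g))"
        using that K(1) by (intro mult_left_mono) (auto simp: P dist_norm)
      also have "\<dots> = (2 ^ m * \<sigma> ^ g) * (K * r)"
        by simp
      also have "\<dots> \<le> 2 * (K * r)"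
        using power_2_\<sigma>_le[of g] K(1) assms(2) by (intro mult_right_mono) (auto simp: m_def)
      finally show ?thesis
        by (simp add: w_def)
    qed
    define I where "I i = {\<lfloor>c z i - w\<rfloor>..\<lfloor>c z i + w\<rfloor>}" for i
    define \<phi> where "\<phi> x = (\<lfloor>c x 1\<rfloor>, \<lfloor>c x 2\<rfloor>)" for x
    have cI: "\<lfloor>c x i\<rfloor> \<in> I i" if "x \<in> P" for x i
      using near[OF that, of i] by (auto simp: I_def intro!: floor_mono)
    have "inj_on \<phi> P"
    proof (rule inj_onI)
      fix x y assume xy: "x \<in> P" "y \<in> P" "\<phi> x = \<phi> y"
      have int: "c x i \<in> \<int>" "c y i \<in> \<int>" for i
        using xy by (auto simp: P lattice_point_def c_def m_def)
      have "\<lfloor>c x i\<rfloor> = \<lfloor>c y i\<rfloor>" for i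
        using xy(3) exhaust_2[of i] by (auto simp: \<phi>_def)
      then have "c x i = c y i" for i
        using int by (metis Ints_cases floor_of_int)
      then have "L (x - nv R) = L (y - nv R)"
        by (simp add: vec_eq_iff c_def)
      then show "x = y"
        using \<open>inj L\<close> by (metis diff_add_cancel injD)
    qed
    moreover have "\<phi> ` P \<subseteq> I 1 \<times> I 2"
      using cI by (auto simp: \<phi>_def)
    moreover have "finite (I 1 \<times> I 2)"
      by (simp add: I_def)
    ultimately have "finite P" "card P \<le> card (I 1 \<times> I 2)"
      by (auto intro: inj_on_finite card_inj_on_le)
    moreover have "card (I i) \<le> nat \<lceil>2 * w + 2\<rceil>" for i
    proof -
      have "real (card (I i)) \<le> 2 * w + 2"
        unfolding I_def by (rule card_integers_near[OF w])
      then show ?thesis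
        by linarith
    qed
    then have "card (I 1 \<times> I 2) \<le> N"
      unfolding N_def card_cartesian_product by (intro mult_mono) auto
    ultimately show ?thesis
      by linarith
  qed
  then show ?thesis
    by blast
qed

lemma descendant_diameter:
  assumes "chart R L"
  shows "\<exists>\<delta>>0. \<forall>g E x. descendant R g E \<longrightarrow> x \<in> region E \<longrightarrow> dist (nv E) x \<le> \<delta> * \<sigma> ^ g"
proof -
  have "linear L" "inj L"
    using assms by (auto simp: chart_def)
  then obtain B where B: "0 < B" "\<And>x. B * norm x \<le> norm (L x)"
    using linear_inj_bounded_below_pos by blast
  have "dist (nv E) x \<le> (2 / B) * \<sigma> ^ g" if E: "descendant R g E" and x: "x \<in> region E" for g E x
  proof -
    obtain p u v where puv: "E = corner p u v" "norm (L u) = \<sigma> ^ g" "norm (L v) = \<sigma> ^ g"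
      using descendant_frame[OF assms E] by blast
    obtain a b where ab: "0 \<le> a" "0 \<le> b" "a + b \<le> 1" "x = p + a *\<^sub>R u + b *\<^sub>R v"
      using x puv(1) region_cornerE by metis
    have "norm u \<le> \<sigma> ^ g / B" "norm v \<le> \<sigma> ^ g / B"
      using B(2)[of u] B(2)[of v] puv B(1) by (simp_all add: field_simps)
    moreover have "dist (nv E) x \<le> a * norm u + b * norm v"
      using ab norm_triangle_ineq[of "a *\<^sub>R u" "b *\<^sub>R v"]
      by (simp add: dist_norm puv(1) add.assoc del: add.commute flip: norm_minus_cancel[of "_ + _"])
    moreover have "a * norm u \<le> norm u" "b * norm v \<le> norm v"
      using ab by (auto intro!: mult_left_le_one_le)
    ultimately show ?thesis
      by simp
  qed
  then show ?thesis
    using B(1) by (intro exI[of _ "2 / B"]) auto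
qed

text \<open>A triangle is determined by its set of vertices and its newest vertex, all of which are lattice
  points near \<open>z\<close>.\<close>

lemma descendants_near:
  assumes "chart R L" and "0 < r"
  shows "\<exists>N. \<forall>g z. finite {E. descendant R g E \<and> dist (nv E) z \<le> r * \<sigma> ^ g} \<and>
           card {E. descendant R g E \<and> dist (nv E) z \<le> r * \<sigma> ^ g} \<le> N"
proof -
  obtain \<delta> where \<delta>: "0 < \<delta>"
      "\<And>g E x. descendant R g E \<Longrightarrow> x \<in> region E \<Longrightarrow> dist (nv E) x \<le> \<delta> * \<sigma> ^ g"
    using descendant_diameter[OF assms(1)] by blast
  define P where "P g z = {x. lattice_point R L (Suc g div 2) x \<and> dist x z \<le> (\<delta> + r) * \<sigma> ^ g}" for g z
  obtain N where N: "\<And>g z. finite (P g z)" "\<And>g z. card (P g z) \<le> N"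
    using lattice_points_near[OF assms(1), of "\<delta> + r"] \<delta>(1) assms(2) unfolding P_def by auto
  have "finite S \<and> card S \<le> 2 ^ N * N"
    if S: "S = {E. descendant R g E \<and> dist (nv E) z \<le> r * \<sigma> ^ g}" for S g z
  proof -
    have verts: "verts E \<subseteq> P g z" if "E \<in> S" for E
    proof
      fix x assume x: "x \<in> verts E"
      have "x \<in> region E"
        using x verts_subset_region by blast
      then have "dist (nv E) x \<le> \<delta> * \<sigma> ^ g"
        using \<delta>(2) that by (simp add: S)
      then have "dist x z \<le> (\<delta> + r) * \<sigma> ^ g"
        using that dist_triangle[of x z "nv E"] by (simp add: S dist_commute algebra_simps)
      moreover have "lattice_point R L (Suc g div 2) x"
        using descendant_lattice[OF assms(1)] that x by (auto simp: S)
      ultimately show "x \<in> P g z"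
        by (simp add: P_def)
    qed
    have "E \<in> (\<lambda>(V, n). Triangle V n) ` (Pow (P g z) \<times> P g z)" if "E \<in> S" for E
    proof -
      have "nv E \<in> verts E"
        using descendant_frame[OF assms(1)] that by (fastforce simp: S)
      then have "(verts E, nv E) \<in> Pow (P g z) \<times> P g z"
        using verts[OF that] by blast
      moreover have "E = (\<lambda>(V, n). Triangle V n) (verts E, nv E)"
        by simp
      ultimately show ?thesis
        by (rule rev_image_eqI)
    qed
    then have sub: "S \<subseteq> (\<lambda>(V, n). Triangle V n) ` (Pow (P g z) \<times> P g z)"
      by blast
    have fin: "finite (Pow (P g z) \<times> P g z)"
      using N(1) by simp
    have "card S \<le> card (Pow (P g z) \<times> P g z)"
      using sub fin by (rule surj_card_le[rotated])
    also have "\<dots> \<le> 2 ^ N * N"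
      using N by (auto simp: card_cartesian_product card_Pow intro!: mult_mono power_increasing)
    finally show ?thesis
      using finite_subset[OF sub] fin by blast
  qed
  then show ?thesis
    by blast
qed

section \<open>Generations\<close>

locale labelled_mesh =
  fixes D :: "point set" and T0 :: mesh
  assumes conforming: "conforming_triangulation D T0"
    and suitable: "suitable_labeling T0"
begin

definition has_generation :: "triangle \<Rightarrow> nat \<Rightarrow> bool" where
  "has_generation E g \<longleftrightarrow> (\<exists>R\<in>T0. descendant R g E)"

text \<open>Meaningful on \<open>forest\<close> only, where the generation is unique by \<open>has_generation_unique\<close>.\<close>

definition gen :: "triangle \<Rightarrow> nat" where
  "gen E = (THE g. has_generation E g)"

text \<open>All triangles that any sequence of bisections of the initial mesh can produce.\<close>

definition forest :: "triangle set" where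
  "forest = {E. \<exists>g. has_generation E g}"

lemma finite_T0: "finite T0"
  using conforming by (simp add: conforming_triangulation_def)

lemma root_triangle: "R \<in> T0 \<Longrightarrow> is_triangle R"
  using conforming by (simp add: conforming_triangulation_def)

lemma root_chart: "R \<in> T0 \<Longrightarrow> \<exists>L. chart R L"
  using chart_exists root_triangle by blast

lemma forest_corner:
  assumes "E \<in> forest"
  obtains p u v where "E = corner p u v" "det2 u v \<noteq> 0"
  using assms root_chart descendant_frame unfolding forest_def has_generation_def by blast

text \<open>Distinct roots meet in at most a segment, which cannot contain a nondegenerate triangle.\<close>

lemma common_descendant:
  assumes R: "R \<in> T0" "R' \<in> T0" and E: "descendant R g E" "descendant R' g' E"
  shows "R = R'"
proof (rule ccontr)
  assume "R \<noteq> R'"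
  obtain p u v where puv: "E = corner p u v" "det2 u v \<noteq> 0"
    using R E root_chart descendant_frame by blast
  have sub: "region E \<subseteq> region R \<inter> region R'"
    using descendant_region_subset E R root_triangle by blast
  then have mem: "p \<in> region R \<inter> region R'" "p + u \<in> region R \<inter> region R'"
      "p + v \<in> region R \<inter> region R'"
    using verts_subset_region[of E] by (auto simp: puv)
  have "region R \<inter> region R' = {} \<or> (\<exists>z\<in>verts R \<inter> verts R'. region R \<inter> region R' = {z}) \<or>
      region R \<inter> region R' \<in> sides R \<inter> sides R'"
    using conforming R \<open>R \<noteq> R'\<close> unfolding conforming_triangulation_def by metis
  moreover have "p + u \<noteq> p"
    using det2_legs[OF puv(2)] by simp
  ultimately have "region R \<inter> region R' \<in> sides R"
    using mem by (metis IntD1 empty_iff singletonD)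
  then obtain c d where "region R \<inter> region R' = closed_segment c d"
    by (auto simp: sides_def)
  with mem obtain a1 a2 a3 where a: "p = (1 - a1) *\<^sub>R c + a1 *\<^sub>R d"
      "p + u = (1 - a2) *\<^sub>R c + a2 *\<^sub>R d" "p + v = (1 - a3) *\<^sub>R c + a3 *\<^sub>R d"
    by (auto simp: in_segment)
  have "u = (a2 - a1) *\<^sub>R (d - c)"
    using a(2) by (subst (asm) a(1)) (simp add: algebra_simps)
  moreover have "v = (a3 - a1) *\<^sub>R (d - c)"
    using a(3) by (subst (asm) a(1)) (simp add: algebra_simps)
  ultimately have "det2 u v = 0"
    by (simp add: det2_def)
  then show False
    using puv by simp
qed

text \<open>The length of a leg in the chart of the root determines the generation.\<close>

lemma has_generation_unique:
  assumes "has_generation E g" "has_generation E g'"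
  shows "g = g'"
proof -
  obtain R where R: "R \<in> T0" "descendant R g E" "descendant R g' E"
    using assms common_descendant unfolding has_generation_def by metis
  obtain L where L: "chart R L"
    using root_chart R(1) by blast
  obtain p u v where "E = corner p u v" "det2 u v \<noteq> 0"
    using descendant_frame[OF L R(2)] by blast
  then have "p + u \<in> oe_ends E"
    by (simp add: oe_ends_corner)
  then have "\<sigma> ^ g = \<sigma> ^ g'"
    using descendant_leg_norm[OF L R(2)] descendant_leg_norm[OF L R(3)] by simp
  then show ?thesis
    by (metis \<sigma>_le_iff order_antisym order_refl)
qed

lemma gen_eq: "has_generation E g \<Longrightarrow> gen E = g"
  unfolding gen_def using has_generation_unique by blast

lemma forest_gen: "E \<in> forest \<Longrightarrow> \<exists>R\<in>T0. descendant R (gen E) E"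
  unfolding forest_def using gen_eq has_generation_def by auto

lemma root_forest:
  assumes "E \<in> T0"
  shows "E \<in> forest" "gen E = 0"
proof -
  have "has_generation E 0"
    using assms descendant_refl by (auto simp: has_generation_def)
  then show "E \<in> forest" "gen E = 0"
    using gen_eq by (auto simp: forest_def)
qed

lemma gen_0_root:
  assumes "E \<in> forest" "gen E = 0"
  shows "E \<in> T0"
  using forest_gen[OF assms(1)] assms(2) by (auto elim: descendant.cases)

lemma child_forest:
  assumes "E \<in> forest" "C \<in> children E"
  shows "C \<in> forest" "gen C = Suc (gen E)"
proof -
  have "has_generation C (Suc (gen E))"
    using forest_gen[OF assms(1)] descendant_child[OF _ assms(2)] has_generation_def by blast
  then show "C \<in> forest" "gen C = Suc (gen E)"
    using gen_eq by (auto simp: forest_def)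
qed

lemma finite_children:
  assumes "E \<in> forest"
  shows "finite (children E)"
  using assms by (auto elim!: forest_corner simp: children_corner)

lemma nv_child_in_region:
  assumes "E \<in> forest" "C \<in> children E"
  shows "nv C \<in> region E" "region C \<subseteq> region E"
proof -
  show sub: "region C \<subseteq> region E"
    using assms region_child_subset by (metis forest_corner)
  have "nv C \<in> region C"
    using assms(2) verts_subset_region[of C] by (auto simp: children_def)
  then show "nv C \<in> region E"
    using sub by blast
qed

lemma bisect_forest:
  assumes "T \<subseteq> forest" "finite T" "E \<in> T"
  shows "bisect T E \<subseteq> forest" "finite (bisect T E)"
  using assms child_forest finite_children by (auto simp: bisect_def)

lemma facing_gen:
  assumes "E \<in> forest" "F \<in> forest" "facing T E F"
  shows "gen F \<le> gen E" and "\<not> compatible F E \<Longrightarrow> gen F < gen E"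
proof -
  obtain R R' where "R \<in> T0" "R' \<in> T0" "descendant R (gen E) E" "descendant R' (gen F) F"
    using assms forest_gen by blast
  then show "gen F \<le> gen E" "\<not> compatible F E \<Longrightarrow> gen F < gen E"
    using facing_generation[OF conforming suitable _ _ _ _ assms(3)] by blast+
qed

lemma forest_diameter:
  "\<exists>\<delta>>0. \<forall>E\<in>forest. \<forall>x\<in>region E. dist (nv E) x \<le> \<delta> * \<sigma> ^ gen E"
proof -
  have "\<forall>R\<in>T0. \<exists>\<delta>>0. \<forall>g E x. descendant R g E \<longrightarrow> x \<in> region E \<longrightarrow> dist (nv E) x \<le> \<delta> * \<sigma> ^ g"
    using root_chart descendant_diameter by blast
  then obtain d where d: "\<And>R. R \<in> T0 \<Longrightarrow> 0 < d R"
      "\<And>R g E x. R \<in> T0 \<Longrightarrow> descendant R g E \<Longrightarrow> x \<in> region E \<Longrightarrow> dist (nv E) x \<le> d R * \<sigma> ^ g"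
    by metis
  define \<delta> where "\<delta> = 1 + (\<Sum>R\<in>T0. d R)"
  have le: "d R \<le> \<delta>" if "R \<in> T0" for R
    using member_le_sum[of R T0 d] that d(1) finite_T0 by (auto simp: \<delta>_def less_imp_le)
  have "0 < \<delta>"
    unfolding \<delta>_def using d(1) by (intro add_pos_nonneg sum_nonneg) (auto intro: less_imp_le)
  moreover have "dist (nv E) x \<le> \<delta> * \<sigma> ^ gen E" if E: "E \<in> forest" "x \<in> region E" for E x
  proof -
    obtain R where R: "R \<in> T0" "descendant R (gen E) E"
      using forest_gen[OF E(1)] by blast
    then have "dist (nv E) x \<le> d R * \<sigma> ^ gen E"
      using d(2) E(2) by blast
    also have "\<dots> \<le> \<delta> * \<sigma> ^ gen E"
      using le[OF R(1)] \<sigma>_bounds by (intro mult_right_mono) auto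
    finally show ?thesis .
  qed
  ultimately show ?thesis
    by blast
qed

lemma forest_near:
  assumes "0 < r"
  shows "\<exists>N. \<forall>g z. finite {E\<in>forest. gen E = g \<and> dist (nv E) z \<le> r * \<sigma> ^ g} \<and>
           card {E\<in>forest. gen E = g \<and> dist (nv E) z \<le> r * \<sigma> ^ g} \<le> N"
proof -
  define A where "A R g z = {E. descendant R g E \<and> dist (nv E) z \<le> r * \<sigma> ^ g}" for R g z
  have "\<forall>R\<in>T0. \<exists>N. \<forall>g z. finite (A R g z) \<and> card (A R g z) \<le> N"
    unfolding A_def using root_chart descendants_near[OF _ assms] by blast
  then obtain N where N: "\<And>R g z. R \<in> T0 \<Longrightarrow> finite (A R g z)"
      "\<And>R g z. R \<in> T0 \<Longrightarrow> card (A R g z) \<le> N R"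
    by metis
  have "finite S \<and> card S \<le> (\<Sum>R\<in>T0. N R)"
    if S: "S = {E\<in>forest. gen E = g \<and> dist (nv E) z \<le> r * \<sigma> ^ g}" for S g z
  proof -
    have sub: "S \<subseteq> (\<Union>R\<in>T0. A R g z)"
      using forest_gen by (auto simp: S A_def)
    have fin: "finite (\<Union>R\<in>T0. A R g z)"
      using N(1) finite_T0 by blast
    have "card S \<le> card (\<Union>R\<in>T0. A R g z)"
      using sub fin by (rule card_mono[rotated])
    also have "\<dots> \<le> (\<Sum>R\<in>T0. card (A R g z))"
      by (rule card_UN_le[OF finite_T0])
    also have "\<dots> \<le> (\<Sum>R\<in>T0. N R)"
      using N(2) by (rule sum_mono)
    finally show ?thesis
      using finite_subset[OF sub fin] by blast
  qed
  then show ?thesis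
    by blast
qed

section \<open>What one chain creates\<close>

definition diameter_bound :: "real \<Rightarrow> bool" where
  "diameter_bound \<delta> \<longleftrightarrow> 0 < \<delta> \<and> (\<forall>E\<in>forest. \<forall>x\<in>region E. dist (nv E) x \<le> \<delta> * \<sigma> ^ gen E)"

text \<open>The two triangles touch and \<open>F\<close> is the larger one up to constants, as \<open>gen F \<le> gen E\<close>.\<close>

lemma facing_dist:
  assumes \<delta>: "diameter_bound \<delta>" and EF: "E \<in> forest" "F \<in> forest" "facing T E F"
    and x: "x \<in> region F"
  shows "dist x (nv E) \<le> 3 * \<delta> * \<sigma> ^ gen F"
proof -
  obtain p u v where puv: "E = corner p u v" "det2 u v \<noteq> 0"
    using EF(1) by (rule forest_corner)
  have "region E \<inter> region F = closed_segment (p + u) (p + v)"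
    using EF(3) puv by (simp add: facing_def oe_corner)
  then have "p + u \<in> region E" "p + u \<in> region F"
    by blast+
  then have "dist (nv E) (p + u) \<le> \<delta> * \<sigma> ^ gen E" "dist (nv F) (p + u) \<le> \<delta> * \<sigma> ^ gen F"
      "dist (nv F) x \<le> \<delta> * \<sigma> ^ gen F"
    using \<delta> EF x by (auto simp: diameter_bound_def)
  moreover have "\<delta> * \<sigma> ^ gen E \<le> \<delta> * \<sigma> ^ gen F"
    using \<delta> facing_gen(1)[OF EF] by (intro mult_left_mono \<sigma>_mono) (auto simp: diameter_bound_def)
  ultimately show ?thesis
    using dist_triangle[of x "nv E" "p + u"] dist_triangle[of x "p + u" "nv F"]
      dist_commute[of x "nv F"] dist_commute[of "p + u" "nv E"]
    by linarith
qed

lemma \<sigma>_le_three_quarters: "\<sigma> \<le> 3 / 4"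
proof (rule power2_le_imp_le)
  show "\<sigma>\<^sup>2 \<le> (3 / 4)\<^sup>2"
    unfolding \<sigma>_sq by (simp add: power_divide)
qed simp

text \<open>Induction along the chain needs a distance bound that leaves room for further steps: the negative
  term shrinks when passing to the predecessor, whose generation \<open>g\<close> is larger, and this pays for the
  distance between consecutive elements.  Here \<open>f\<close> is the generation of an element that is bisected,
  \<open>x\<close> that of a child or grandchild of it, and \<open>30 = 2 * (3 + 12)\<close> covers the factor
  \<open>\<sigma> ^ x \<ge> \<sigma> ^ f / 2\<close>.\<close>

lemma descendants_of_facing_near:
  assumes "0 < \<delta>" "f \<le> g" "x \<le> Suc (Suc f)" "d \<le> 3 * \<delta> * \<sigma> ^ f"
  shows "d \<le> 30 * \<delta> * \<sigma> ^ x - 12 * \<delta> * \<sigma> ^ g"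
proof -
  have "\<sigma> ^ Suc (Suc f) \<le> \<sigma> ^ x"
    using assms(3) by (rule \<sigma>_mono)
  moreover have "\<sigma> ^ Suc (Suc f) = \<sigma>\<^sup>2 * \<sigma> ^ f"
    by (simp add: power2_eq_square)
  ultimately have "\<sigma> ^ f \<le> 2 * \<sigma> ^ x"
    unfolding \<sigma>_sq by linarith
  then have "\<delta> * \<sigma> ^ f \<le> \<delta> * (2 * \<sigma> ^ x)"
    using assms(1) by (intro mult_left_mono) auto
  moreover have "\<delta> * \<sigma> ^ g \<le> \<delta> * \<sigma> ^ f"
    using assms(1,2) by (intro mult_left_mono \<sigma>_mono) auto
  ultimately show ?thesis
    using assms(4) by simp
qed

text \<open>By induction along the chain.  An element created further down the chain has generation at most
  \<open>gen F + 1 \<le> gen E\<close> and is close to the facing element \<open>F\<close>; the step from \<open>F\<close> to \<open>E\<close> costs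
  \<open>3 * \<delta> * \<sigma> ^ gen F\<close>, which is available because
  \<open>12 * \<sigma> ^ gen E \<le> 9 * \<sigma> ^ gen F\<close>.\<close>

lemma traverse_back_new:
  assumes \<delta>: "diameter_bound \<delta>"
    and "traverse_back T Es S" "is_chain T0 \<Lambda> T Es" "T \<subseteq> forest" "finite T" "hd Es \<in> forest"
  shows "S \<subseteq> forest \<and> finite S \<and>
    (\<forall>X\<in>S - T. gen X \<le> Suc (gen (hd Es)) \<and>
       dist (nv X) (nv (hd Es)) \<le> 30 * \<delta> * \<sigma> ^ gen X - 12 * \<delta> * \<sigma> ^ gen (hd Es))"
  using assms(2-)
proof induction
  case (traverse_start E)
  then show ?case by simp
next
  case (traverse_once F Es S E)
  from traverse_once.prems(1) traverse_once.hyps(3) have fac: "facing T E F" and Es: "Es = []"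
    by (auto elim: is_chain.cases)
  \<comment> \<open>A compatible facing element ends the chain, so nothing has been bisected before it.\<close>
  then have "S = T"
    using traverse_once.hyps(1) by (auto elim: traverse_back.cases)
  have E: "E \<in> forest" and F: "F \<in> T" "F \<in> forest"
    using traverse_once.prems fac by (auto simp: facing_def)
  note le = facing_gen(1)[OF E F(2) fac]
  have "gen X \<le> Suc (gen E) \<and> dist (nv X) (nv E) \<le> 30 * \<delta> * \<sigma> ^ gen X - 12 * \<delta> * \<sigma> ^ gen E"
    if X: "X \<in> children F" for X
  proof -
    have g: "gen X = Suc (gen F)"
      using child_forest F(2) X by blast
    have "dist (nv X) (nv E) \<le> 3 * \<delta> * \<sigma> ^ gen F"
      using facing_dist[OF \<delta> E F(2) fac] nv_child_in_region[OF F(2) X] by blast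
    then show ?thesis
      using descendants_of_facing_near[OF _ le, of \<delta> "gen X"] g le \<delta>
      by (simp add: diameter_bound_def)
  qed
  then show ?case
    using bisect_forest[OF traverse_once.prems(2,3) F(1)] by (auto simp: bisect_def \<open>S = T\<close>)
next
  case (traverse_twice F Es S E G)
  from traverse_twice.prems(1) traverse_twice.hyps(3)
  have fac: "facing T E F" and chain: "is_chain T0 \<Lambda> T (F # Es)"
    by (auto elim: is_chain.cases)
  have E: "E \<in> forest" and F: "F \<in> T" "F \<in> forest"
    using traverse_twice.prems fac by (auto simp: facing_def)
  note lt = facing_gen(2)[OF E F(2) fac traverse_twice.hyps(3)]
  have IH: "S \<subseteq> forest" "finite S" "\<And>X. X \<in> S - T \<Longrightarrow> gen X \<le> Suc (gen F) \<and>
      dist (nv X) (nv F) \<le> 30 * \<delta> * \<sigma> ^ gen X - 12 * \<delta> * \<sigma> ^ gen F"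
    using traverse_twice.IH[OF chain] traverse_twice.prems F by auto
  have G: "G \<in> bisect S F" "G \<in> forest" "gen G = Suc (gen F)"
    using traverse_twice.hyps(4) child_forest[OF F(2)] by (auto simp: bisect_def)
  have pos: "0 < \<delta>"
    using \<delta> by (simp add: diameter_bound_def)
  have new: "gen X \<le> Suc (gen E) \<and> dist (nv X) (nv E) \<le> 30 * \<delta> * \<sigma> ^ gen X - 12 * \<delta> * \<sigma> ^ gen E"
    if X: "X \<in> children F \<or> X \<in> children G" for X
  proof -
    have g: "gen X \<le> Suc (Suc (gen F))"
      using child_forest(2)[OF F(2)] child_forest(2)[OF G(2)] G(3) X by auto
    have "nv X \<in> region F"
      using X nv_child_in_region[OF F(2)] nv_child_in_region[OF G(2)] traverse_twice.hyps(4) by blast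
    then have "dist (nv X) (nv E) \<le> 3 * \<delta> * \<sigma> ^ gen F"
      using facing_dist[OF \<delta> E F(2) fac] by blast
    then show ?thesis
      using descendants_of_facing_near[OF pos less_imp_le[OF lt] g] g lt by simp
  qed
  \<comment> \<open>Elements created by the part of the chain that starts at \<open>F\<close>.\<close>
  have old: "gen X \<le> Suc (gen E) \<and> dist (nv X) (nv E) \<le> 30 * \<delta> * \<sigma> ^ gen X - 12 * \<delta> * \<sigma> ^ gen E"
    if X: "X \<in> S - T" for X
  proof -
    have "nv F \<in> region F"
      using F(2) by (metis forest_corner insertI1 nv_corner subsetD verts_corner verts_subset_region)
    then have "dist (nv F) (nv E) \<le> 3 * \<delta> * \<sigma> ^ gen F"
      using facing_dist[OF \<delta> E F(2) fac] by blast
    then have "dist (nv X) (nv E) \<le> 30 * \<delta> * \<sigma> ^ gen X - 9 * \<delta> * \<sigma> ^ gen F"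
      using IH(3)[OF X] dist_triangle[of "nv X" "nv E" "nv F"] by simp
    moreover have "\<sigma> ^ gen E \<le> (3 / 4) * \<sigma> ^ gen F"
    proof -
      have "\<sigma> ^ gen E \<le> \<sigma> * \<sigma> ^ gen F"
        using \<sigma>_mono[of "Suc (gen F)" "gen E"] lt by simp
      also have "\<dots> \<le> (3 / 4) * \<sigma> ^ gen F"
        using \<sigma>_le_three_quarters \<sigma>_bounds by (intro mult_right_mono) auto
      finally show ?thesis .
    qed
    then have "\<delta> * \<sigma> ^ gen E \<le> \<delta> * ((3 / 4) * \<sigma> ^ gen F)"
      using pos by (intro mult_left_mono) auto
    ultimately show ?thesis
      using IH(3)[OF X] lt by simp
  qed
  have "bisect S F \<subseteq> forest" "finite (bisect S F)"
    using bisect_forest[OF IH(1,2) traverse_twice.hyps(2)] by auto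
  then have "bisect (bisect S F) G \<subseteq> forest" "finite (bisect (bisect S F) G)"
    using bisect_forest G(1) by blast+
  moreover have "X \<in> S - T \<or> X \<in> children F \<or> X \<in> children G"
    if "X \<in> bisect (bisect S F) G - T" for X
    using that by (auto simp: bisect_def)
  ultimately show ?case
    using new old by auto
qed

lemma create_admissible_chain_new:
  assumes \<delta>: "diameter_bound \<delta>" and T: "T \<subseteq> forest" "finite T"
    and E: "E \<in> T" and chain: "create_admissible_chain T0 \<Lambda> T E T'"
  shows "T' \<subseteq> forest" "finite T'"
    "\<And>X. X \<in> T' - T \<Longrightarrow> gen X \<le> Suc (gen E) \<and> dist (nv X) (nv E) \<le> 30 * \<delta> * \<sigma> ^ gen X"
proof -
  obtain Es S where S: "is_chain T0 \<Lambda> T (E # Es)" "traverse_back T (E # Es) S" "E \<in> S"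
      "T' = bisect S E"
    using chain unfolding create_admissible_chain_def by blast
  have Ef: "E \<in> forest"
    using T E by blast
  have new: "S \<subseteq> forest" "finite S" "\<And>X. X \<in> S - T \<Longrightarrow> gen X \<le> Suc (gen E) \<and>
      dist (nv X) (nv E) \<le> 30 * \<delta> * \<sigma> ^ gen X - 12 * \<delta> * \<sigma> ^ gen E"
    using traverse_back_new[OF \<delta> S(2,1) T] Ef by auto
  show "T' \<subseteq> forest" "finite T'"
    using bisect_forest[OF new(1,2) S(3)] S(4) by auto
  have pos: "0 \<le> 12 * \<delta> * \<sigma> ^ gen E"
    using \<delta> \<sigma>_bounds by (simp add: diameter_bound_def)
  show "gen X \<le> Suc (gen E) \<and> dist (nv X) (nv E) \<le> 30 * \<delta> * \<sigma> ^ gen X" if X: "X \<in> T' - T" for X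
  proof (cases "X \<in> children E")
    case True
    have "dist (nv X) (nv E) \<le> \<delta> * \<sigma> ^ gen E"
      using nv_child_in_region(1)[OF Ef True] Ef \<delta>
      by (simp add: diameter_bound_def dist_commute[of "nv X"])
    also have "\<dots> \<le> 3 * \<delta> * \<sigma> ^ gen E"
      using pos by simp
    finally have "dist (nv X) (nv E) \<le> 30 * \<delta> * \<sigma> ^ gen X - 12 * \<delta> * \<sigma> ^ gen E"
      using \<delta> child_forest[OF Ef True] by (intro descendants_of_facing_near) (auto simp: diameter_bound_def)
    then show ?thesis
      using child_forest[OF Ef True] pos by simp
  next
    case False
    then have "X \<in> S - T"
      using X S(4) by (auto simp: bisect_def)
    then show ?thesis
      using new(3) pos by fastforce
  qed
qed

section \<open>Charging elements to marked elements\<close>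

text \<open>The list contains the elements for which a chain was processed, the most recent one first.  Marked
  elements that had already been bisected contribute nothing.\<close>

inductive history :: "nat \<Rightarrow> triangle list \<Rightarrow> mesh \<Rightarrow> bool" for \<Lambda> where
  history_Nil: "history \<Lambda> [] T0"
| history_Cons: "history \<Lambda> Ms T \<Longrightarrow> E \<in> T \<Longrightarrow> create_admissible_chain T0 \<Lambda> T E T' \<Longrightarrow>
    history \<Lambda> (E # Ms) T'"

lemma history_forest:
  assumes "history \<Lambda> Ms T"
  shows "T \<subseteq> forest \<and> finite T \<and> set Ms \<subseteq> forest"
  using assms
proof induction
  case history_Nil
  then show ?case
    using root_forest finite_T0 by auto
next
  case (history_Cons Ms T E T')
  obtain \<delta> where \<delta>: "diameter_bound \<delta>"
    using forest_diameter unfolding diameter_bound_def by blast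
  have "T \<subseteq> forest" "finite T"
    using history_Cons.IH by auto
  from create_admissible_chain_new(1,2)[OF \<delta> this history_Cons.hyps(2,3)]
  show ?case
    using history_Cons by auto
qed

lemma history_refine_list:
  assumes "refine_list T0 \<Lambda> T Es T'" "history \<Lambda> Ms T"
  shows "\<exists>Ms'. history \<Lambda> Ms' T' \<and> length Ms' \<le> length Ms + length Es"
  using assms
proof (induction arbitrary: Ms)
  case (refine_Nil T)
  then show ?case
    by (intro exI[of _ Ms]) simp
next
  case (refine_in E T T' Es T'')
  then obtain Ms' where "history \<Lambda> Ms' T''" "length Ms' \<le> length (E # Ms) + length Es"
    using history_Cons by meson
  then show ?case
    by auto
next
  case (refine_notin E T Es T'')
  then obtain Ms' where "history \<Lambda> Ms' T''" "length Ms' \<le> length Ms + length Es"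
    by blast
  then show ?case
    by auto
qed

lemma history_refine_sequence:
  assumes "T 0 = T0" "\<forall>j<k. refine T0 \<Lambda> (T j) (M j) (T (Suc j))"
  shows "\<exists>Ms. history \<Lambda> Ms (T k) \<and> length Ms \<le> (\<Sum>j<k. card (M j))"
  using assms(2)
proof (induction k)
  case 0
  then show ?case
    using history_Nil assms(1) by auto
next
  case (Suc k)
  then obtain Ms where Ms: "history \<Lambda> Ms (T k)" "length Ms \<le> (\<Sum>j<k. card (M j))"
    by auto
  obtain Es where Es: "distinct Es" "set Es = M k" "refine_list T0 \<Lambda> (T k) Es (T (Suc k))"
    using Suc.prems by (auto simp: refine_def)
  then have "length Es = card (M k)"
    by (metis distinct_card)
  then show ?case
    using history_refine_list[OF Es(3) Ms(1)] Ms(2) by fastforce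
qed

text \<open>The collecting walk, by induction on the history.  Up to the factor \<open>30 * \<delta>\<close>, the amount
  \<open>c\<close> still to be collected bounds the distance to be covered after the first step: the step from \<open>X\<close> to the marked element \<open>E\<close> that created
  it has length at most \<open>30 * \<delta> * \<sigma> ^ gen X\<close>, collects \<open>\<sigma> ^ gen E\<close>, and leaves
  \<open>c - \<sigma> ^ gen E\<close> to be collected from \<open>E\<close> onwards.  If the walk reaches generation \<open>h - 1\<close>, it has
  collected enough since \<open>c \<le> \<sigma> ^ h\<close>; it cannot jump over that generation, and so it ends at the
  latest when it meets an element of the initial mesh.\<close>

lemma marked_weight:
  assumes \<delta>: "diameter_bound \<delta>" and "history \<Lambda> Ms T" "X \<in> T" "1 \<le> h" "h \<le> gen X"
    "0 \<le> c" "c \<le> \<sigma> ^ h"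
  shows "c \<le> (\<Sum>E\<leftarrow>Ms. if h \<le> Suc (gen E) \<and> dist (nv X) (nv E) \<le> 30 * \<delta> * (\<sigma> ^ gen X + c)
                   then \<sigma> ^ gen E else 0)"
  using assms(2-)
proof (induction arbitrary: X c)
  case history_Nil
  then show ?case
    using root_forest by auto
next
  case (history_Cons Ms T E T')
  let ?w = "\<lambda>X c E. if h \<le> Suc (gen E) \<and> dist (nv X) (nv E) \<le> 30 * \<delta> * (\<sigma> ^ gen X + c)
      then \<sigma> ^ gen E else 0"
  have pos: "0 < \<delta>"
    using \<delta> by (simp add: diameter_bound_def)
  have w_nonneg: "0 \<le> ?w X c E" for X c E
    using \<sigma>_bounds by simp
  show ?case
  proof (cases "X \<in> T")
    case True
    then have "c \<le> (\<Sum>E\<leftarrow>Ms. ?w X c E)"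
      using history_Cons by blast
    also have "\<dots> \<le> (\<Sum>E\<leftarrow>E # Ms. ?w X c E)"
      using w_nonneg[of E X c] by simp
    finally show ?thesis .
  next
    case False
    have T: "T \<subseteq> forest" "finite T"
      using history_forest history_Cons.hyps(1) by auto
    have X: "gen X \<le> Suc (gen E)" "dist (nv X) (nv E) \<le> 30 * \<delta> * \<sigma> ^ gen X"
      using create_admissible_chain_new(3)[OF \<delta> T history_Cons.hyps(2,3)] False
        history_Cons.prems(1) by auto
    have "30 * \<delta> * \<sigma> ^ gen X \<le> 30 * \<delta> * (\<sigma> ^ gen X + c)"
      using pos history_Cons.prems(4) by simp
    then have wE: "?w X c E = \<sigma> ^ gen E"
      using X history_Cons.prems(3) by simp
    show ?thesis
    proof (cases "c \<le> \<sigma> ^ gen E")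
      case True
      have "0 \<le> (\<Sum>E\<leftarrow>Ms. ?w X c E)"
      proof (rule sum_list_nonneg)
        fix x assume "x \<in> set (map (?w X c) Ms)"
        then obtain F where "x = ?w X c F"
          unfolding set_map by blast
        then show "0 \<le> x"
          using w_nonneg[of F X c] by simp
      qed
      then show ?thesis
        using True wE by simp
    next
      case False
      define c' where "c' = c - \<sigma> ^ gen E"
      have "\<not> \<sigma> ^ h \<le> \<sigma> ^ gen E"
        using False history_Cons.prems(5) by simp
      then have "h \<le> gen E"
        by (simp add: \<sigma>_le_iff)
      moreover have "0 \<le> c'" "c' \<le> \<sigma> ^ h"
        using False history_Cons.prems(5) zero_less_power[OF \<sigma>_bounds(1), of "gen E"]
        by (simp_all add: c'_def)
      ultimately have "c' \<le> (\<Sum>F\<leftarrow>Ms. ?w E c' F)"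
        using history_Cons.IH history_Cons.hyps(2) history_Cons.prems(2) by blast
      also have "\<dots> \<le> (\<Sum>F\<leftarrow>Ms. ?w X c F)"
      proof (rule sum_list_mono)
        fix F
        have "dist (nv X) (nv F) \<le> 30 * \<delta> * (\<sigma> ^ gen X + c)"
          if "dist (nv E) (nv F) \<le> 30 * \<delta> * (\<sigma> ^ gen E + c')"
          using that X(2) dist_triangle[of "nv X" "nv F" "nv E"] by (simp add: c'_def distrib_left)
        then show "?w E c' F \<le> ?w X c F"
          using \<sigma>_bounds by auto
      qed
      finally show ?thesis
        using wE by (simp add: c'_def)
    qed
  qed
qed

lemma sum_inverse_\<sigma>_powers: "(\<Sum>j\<le>n. 1 / \<sigma> ^ j) \<le> 1 / (\<sigma> ^ n * (1 - \<sigma>))"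
proof (induction n)
  case 0
  then show ?case
    using \<sigma>_bounds by (simp add: field_simps)
next
  case (Suc n)
  have "(\<Sum>j\<le>Suc n. 1 / \<sigma> ^ j) \<le> 1 / (\<sigma> ^ n * (1 - \<sigma>)) + 1 / \<sigma> ^ Suc n"
    using Suc.IH by simp
  also have "\<dots> = 1 / (\<sigma> ^ Suc n * (1 - \<sigma>))"
    using \<sigma>_bounds by (simp add: field_simps)
  finally show ?case .
qed

text \<open>For each generation \<open>j \<le> gen E + 1\<close> at most \<open>N\<close> elements receive a charge, each of them
  \<open>\<sigma> ^ gen E / \<sigma> ^ j\<close>, and the powers of \<open>1 / \<sigma>\<close> are dominated by the last one.\<close>

lemma charge_handed_out_le:
  assumes N: "\<And>g z. card {X\<in>forest. gen X = g \<and> dist (nv X) z \<le> r * \<sigma> ^ g} \<le> N"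
    "\<And>g z. finite {X\<in>forest. gen X = g \<and> dist (nv X) z \<le> r * \<sigma> ^ g}"
    and S: "S \<subseteq> forest" "finite S"
  shows "(\<Sum>X\<in>S. if gen X \<le> Suc (gen E) \<and> dist (nv X) (nv E) \<le> r * \<sigma> ^ gen X
           then \<sigma> ^ gen E / \<sigma> ^ gen X else 0) \<le> N / (\<sigma> * (1 - \<sigma>))"
proof -
  define S' where "S' = {X\<in>S. gen X \<le> Suc (gen E) \<and> dist (nv X) (nv E) \<le> r * \<sigma> ^ gen X}"
  have fin: "finite S'"
    using S(2) by (simp add: S'_def)
  have "(\<Sum>X\<in>S. if gen X \<le> Suc (gen E) \<and> dist (nv X) (nv E) \<le> r * \<sigma> ^ gen X
           then \<sigma> ^ gen E / \<sigma> ^ gen X else 0) = (\<Sum>X\<in>S'. \<sigma> ^ gen E / \<sigma> ^ gen X)"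
    unfolding S'_def by (rule sum.inter_filter[symmetric, OF S(2)])
  also have "\<dots> = (\<Sum>j\<le>Suc (gen E). \<Sum>X\<in>{X\<in>S'. gen X = j}. \<sigma> ^ gen E / \<sigma> ^ gen X)"
    by (rule sum.group[symmetric, OF fin]) (auto simp: S'_def)
  also have "\<dots> \<le> (\<Sum>j\<le>Suc (gen E). N * (\<sigma> ^ gen E / \<sigma> ^ j))"
  proof (rule sum_mono)
    fix j
    have "card {X\<in>S'. gen X = j} \<le> card {X\<in>forest. gen X = j \<and> dist (nv X) (nv E) \<le> r * \<sigma> ^ j}"
      using S by (intro card_mono N(2)) (auto simp: S'_def)
    also have "\<dots> \<le> N"
      by (rule N(1))
    finally have "real (card {X\<in>S'. gen X = j}) * (\<sigma> ^ gen E / \<sigma> ^ j) \<le> N * (\<sigma> ^ gen E / \<sigma> ^ j)"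
      using \<sigma>_bounds by (intro mult_right_mono) auto
    then show "(\<Sum>X\<in>{X\<in>S'. gen X = j}. \<sigma> ^ gen E / \<sigma> ^ gen X) \<le> N * (\<sigma> ^ gen E / \<sigma> ^ j)"
      by simp
  qed
  also have "\<dots> = N * \<sigma> ^ gen E * (\<Sum>j\<le>Suc (gen E). 1 / \<sigma> ^ j)"
    by (simp add: sum_distrib_left mult.assoc del: sum.atMost_Suc)
  also have "\<dots> \<le> N * \<sigma> ^ gen E * (1 / (\<sigma> ^ Suc (gen E) * (1 - \<sigma>)))"
    using \<sigma>_bounds by (intro mult_left_mono sum_inverse_\<sigma>_powers) auto
  also have "\<dots> = N / (\<sigma> * (1 - \<sigma>))"
    using \<sigma>_bounds by simp
  finally show ?thesis .
qed

lemma card_new_elements: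
  "\<exists>C>0. \<forall>\<Lambda> Ms T. history \<Lambda> Ms T \<longrightarrow> real (card (T - T0)) \<le> C * real (length Ms)"
proof -
  obtain \<delta> where \<delta>: "diameter_bound \<delta>"
    using forest_diameter unfolding diameter_bound_def by blast
  \<comment> \<open>The radius in the collecting walk started at \<open>X\<close> with \<open>c = \<sigma> ^ gen X\<close>.\<close>
  define r where "r = 60 * \<delta>"
  have "0 < r"
    using \<delta> by (simp add: r_def diameter_bound_def)
  then obtain N where N: "\<And>g z. card {X\<in>forest. gen X = g \<and> dist (nv X) z \<le> r * \<sigma> ^ g} \<le> N"
    "\<And>g z. finite {X\<in>forest. gen X = g \<and> dist (nv X) z \<le> r * \<sigma> ^ g}"
    using forest_near by blast
  define C where "C = real N / (\<sigma> * (1 - \<sigma>))"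
  have "real (card (T - T0)) \<le> C * real (length Ms)" if h: "history \<Lambda> Ms T" for \<Lambda> Ms T
  proof -
    have T: "T \<subseteq> forest" "finite T"
      using history_forest[OF h] by auto
    define w where "w X E = (if gen X \<le> Suc (gen E) \<and> dist (nv X) (nv E) \<le> r * \<sigma> ^ gen X
      then \<sigma> ^ gen E / \<sigma> ^ gen X else 0)" for X E
    have "1 \<le> (\<Sum>E\<leftarrow>Ms. w X E)" if X: "X \<in> T - T0" for X
    proof -
      have "1 \<le> gen X"
        using X T gen_0_root[of X] by (cases "gen X") auto
      then have "\<sigma> ^ gen X \<le> (\<Sum>E\<leftarrow>Ms. if gen X \<le> Suc (gen E) \<and>
          dist (nv X) (nv E) \<le> 30 * \<delta> * (\<sigma> ^ gen X + \<sigma> ^ gen X) then \<sigma> ^ gen E else 0)"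
        using marked_weight[OF \<delta> h, of X "gen X" "\<sigma> ^ gen X"] X \<sigma>_bounds by simp
      also have "\<dots> = (\<Sum>E\<leftarrow>Ms. \<sigma> ^ gen X * w X E)"
        using \<sigma>_bounds by (intro arg_cong[where f = sum_list] map_cong) (auto simp: w_def r_def)
      also have "\<dots> = \<sigma> ^ gen X * (\<Sum>E\<leftarrow>Ms. w X E)"
        by (rule sum_list_const_mult)
      finally show ?thesis
        using \<sigma>_bounds by simp
    qed
    then have "(\<Sum>X\<in>T - T0. 1) \<le> (\<Sum>X\<in>T - T0. \<Sum>E\<leftarrow>Ms. w X E)"
      by (rule sum_mono)
    also have "\<dots> = (\<Sum>E\<leftarrow>Ms. \<Sum>X\<in>T - T0. w X E)"
      by (induction Ms) (simp_all add: sum.distrib)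
    also have "\<dots> \<le> (\<Sum>E\<leftarrow>Ms. C)"
      unfolding w_def C_def using T by (intro sum_list_mono charge_handed_out_le N) auto
    also have "\<dots> = C * real (length Ms)"
      by (simp add: sum_list_triv)
    finally show ?thesis
      by simp
  qed
  \<comment> \<open>The constant must be positive even if \<open>N\<close> is zero.\<close>
  then have "real (card (T - T0)) \<le> (C + 1) * real (length Ms)" if "history \<Lambda> Ms T" for \<Lambda> Ms T
    using that by (simp add: distrib_right add_increasing2)
  moreover have "0 < C + 1"
    using \<sigma>_bounds by (auto simp: C_def intro!: add_nonneg_pos divide_nonneg_pos)
  ultimately show ?thesis
    by blast
qed

end

theorem theorem5p1:
  fixes \<Omega> :: "point set" and T0 :: mesh
  assumes "polygonal_domain \<Omega>" and "bounded \<Omega>"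
    and "conforming_triangulation (closure \<Omega>) T0"
    and "suitable_labeling T0"
  shows "\<exists>C0::real. C0 > 0 \<and>
    (\<forall>(\<Lambda>::nat) (k::nat) (T :: nat \<Rightarrow> mesh) (M :: nat \<Rightarrow> triangle set).
       \<Lambda> \<ge> 1 \<longrightarrow> T 0 = T0 \<longrightarrow>
       (\<forall>j<k. M j \<subseteq> T j \<and> refine T0 \<Lambda> (T j) (M j) (T (Suc j))) \<longrightarrow>
       admissible_refinement T0 \<Lambda> (T k) \<longrightarrow>
       real (card (T k)) - real (card T0) \<le> C0 * (\<Sum>j<k. real (card (M j))))"
proof -
  interpret labelled_mesh "closure \<Omega>" T0
    using assms(3,4) by unfold_locales
  obtain C where C: "0 < C"
      "\<And>\<Lambda> Ms T. history \<Lambda> Ms T \<Longrightarrow> real (card (T - T0)) \<le> C * real (length Ms)"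
    using card_new_elements by blast
  have bound: "real (card (T k)) - real (card T0) \<le> C * (\<Sum>j<k. real (card (M j)))"
    if "T 0 = T0" and refined: "\<forall>j<k. M j \<subseteq> T j \<and> refine T0 \<Lambda> (T j) (M j) (T (Suc j))"
    for \<Lambda> k T M
  proof -
    obtain Ms where Ms: "history \<Lambda> Ms (T k)" "length Ms \<le> (\<Sum>j<k. card (M j))"
      using history_refine_sequence[of T k \<Lambda> M] \<open>T 0 = T0\<close> refined by auto
    have "card (T k) - card T0 \<le> card (T k - T0)"
      by (rule diff_card_le_card_Diff[OF finite_T0])
    then have "real (card (T k)) - real (card T0) \<le> real (card (T k - T0))"
      by linarith
    also have "\<dots> \<le> C * real (length Ms)"
      using C(2) Ms(1) by blast
    also have "\<dots> \<le> C * real (\<Sum>j<k. card (M j))"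
      using C(1) Ms(2) by (intro mult_left_mono) (auto simp flip: of_nat_sum)
    finally show ?thesis
      by simp
  qed
  show ?thesis
  proof (intro exI[of _ C] conjI allI impI)
    fix \<Lambda> k :: nat and T M
    assume "T 0 = T0" "\<forall>j<k. M j \<subseteq> T j \<and> refine T0 \<Lambda> (T j) (M j) (T (Suc j))"
    then show "real (card (T k)) - real (card T0) \<le> C * (\<Sum>j<k. real (card (M j)))"
      by (rule bound[where T = T and k = k and M = M and \<Lambda> = \<Lambda>])
  qed (rule C(1))
qed

end
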